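(* For real $x>-1/6$ let $$f_{3}(x) = \frac{(21x^2+27x+8)\, \Gamma(3x+1)^2}{(2x+1)(6x+1)(6x+5)\,\Gamma(6x+1)}.$$ Then the following series converge and $$\sum_{k=0}^\infty f_{3}'(k)=-12 L_{-3}(2),\qquad \sum_{k=0}^\infty f_{3}''(k)= \frac{32 \pi^3}{9 \sqrt{3}},\qquad \sum_{k=0}^\infty f_{3}'''(k)=54\big( 2 \pi^2 L_{-3}(2) -27 L_{-3}(4)\big).$$
   Context: $\Gamma$ is Euler's gamma function; $f',f'',f'''$ denote derivatives with respect to $x$. For $s=2,4$, $L_{-3}(s)=\sum_{n=0}^\infty \left(\frac1{(3n+1)^s}-\frac1{(3n+2)^s}\right)$ (the Dirichlet $L$-function attached to the character $\left(\frac{-3}{\cdot}\right)$). *)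

theory Defs
  imports "HOL-Analysis.Analysis"
begin

text \<open>Only the restriction of this function to $x > -1/6$ is meaningful; elsewhere the values
  depend on the conventions for division by zero and for Gamma at its poles.\<close>

definition f3 :: "real \<Rightarrow> real" where
  "f3 x = (21 * x\<^sup>2 + 27 * x + 8) * (Gamma (3 * x + 1))\<^sup>2 /
     ((2 * x + 1) * (6 * x + 1) * (6 * x + 5) * Gamma (6 * x + 1))"

definition L_minus3 :: "nat \<Rightarrow> real" where
  "L_minus3 s = (\<Sum>n. 1 / (3 * real n + 1) ^ s - 1 / (3 * real n + 2) ^ s)"

end

theory Submission
  imports Defs "HOL-Complex_Analysis.Cauchy_Integral_Formula"
begin

text \<open>
  Write $s = t(1-t)$ and $B(y) = \int_0^1 s^y\,dt$. Then
  $f_3(x) = \frac43 (B(3x) + B(3x+1) + B(3x+2))$, so the $m$-th derivatives of $f_3$ sum to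
  $\frac43 3^m I_m$ with $I_m = \int_0^1 \ln^m(t(1-t)) / (1-t+t^2)\,dt$, since
  $\sum_n s^n = 1/(1-t+t^2)$.

  Let $\omega$ be the form $dt/(1-t+t^2)$. For $m=1$ expand $1/(1-t+t^2) = (1+t)/(1+t^3)$ in a
  geometric series. For $m=2,3$, a Moebius map takes $(0,1)$ to the arc of the unit circle from
  $1$ to $\zeta = e^{2\pi i/3}$ and $\omega$ to a multiple of $dz/z$. With
  $U = \log(1-z)$, $V = \log(1-\zeta^{-1}z)$, $W = \log(1-\zeta z)$, a cyclic polynomial in
  $U, V, W$ without constant term is invariant under $z \mapsto \zeta z$, so its mean over each of
  the three arcs vanishes. On the arc, $U - W = \ln t - i\pi/3$ and $V - W = \ln(1-t) + i\pi/3$,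
  so each such polynomial in the differences gives a linear relation between the integrals of
  $\ln^i t\,\ln^j(1-t)\,\omega$; these relations determine $I_2$ and reduce $I_3$ to
  $\int \ln^3 t\,\omega$ and $\int \ln t\,\omega$.
\<close>

section \<open>Logarithmic moments\<close>

lemma neg_ln_le_powr:
  fixes x d :: real
  assumes "0 < x" "0 < d"
  shows "- ln x \<le> x powr (- d) / d"
proof -
  have "ln (x powr (- d)) \<le> x powr (- d)"
    using assms by (intro ln_bound) auto
  then show ?thesis
    using assms by (simp add: ln_powr field_simps)
qed

text \<open>Convexity makes exp u - 1 - u nonnegative, and exp u - 1 <= u * exp u bounds it above by
  u * (exp u - 1). This controls the second-order remainder when a moment is differentiated in its
  exponent.\<close>

lemma exp_minus_one_minus_le:
  fixes u :: real
  shows "\<bar>exp u - 1 - u\<bar> \<le> u\<^sup>2 * exp \<bar>u\<bar>"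
proof -
  have step: "exp v - 1 \<le> v * exp v" for v :: real
  proof -
    have "1 - v \<le> exp (- v)"
      using exp_ge_add_one_self[of "- v"] by simp
    then have "(1 - v) * exp v \<le> exp (- v) * exp v"
      by (intro mult_right_mono) auto
    then show ?thesis
      by (simp add: exp_minus_inverse algebra_simps mult_exp_exp)
  qed
  have "u * (exp u - 1) \<le> u\<^sup>2 * exp \<bar>u\<bar>"
  proof (cases "u \<ge> 0")
    case True
    then have "u * (exp u - 1) \<le> u * (u * exp u)"
      by (intro mult_left_mono step)
    with True show ?thesis by (simp add: power2_eq_square)
  next
    case False
    have "u * (exp u - 1) = - u * (1 - exp u)"
      by (simp add: algebra_simps)
    also have "\<dots> \<le> - u * (- u)"
      using False exp_ge_add_one_self[of u] by (intro mult_left_mono) linarith+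
    also have "\<dots> \<le> u\<^sup>2 * exp \<bar>u\<bar>"
      using mult_left_mono[of 1 "exp \<bar>u\<bar>" "u\<^sup>2"] by (simp add: power2_eq_square)
    finally show ?thesis .
  qed
  with step[of u] exp_ge_add_one_self[of u] show ?thesis
    by (simp add: algebra_simps)
qed

text \<open>Common frame for s = t and s = t(1-t) on the unit interval. The bounds on s fix the sign
  of ln s; integrability of the pure powers is the only analytic input.\<close>

locale log_moments =
  fixes M :: "'a measure" and s :: "'a \<Rightarrow> real"
  assumes s_measurable [measurable]: "s \<in> borel_measurable M"
    and s_pos: "t \<in> space M \<Longrightarrow> 0 < s t"
    and s_less_1: "t \<in> space M \<Longrightarrow> s t < 1"
    and integrable_powr: "c > -1 \<Longrightarrow> integrable M (\<lambda>t. s t powr c)"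
begin

definition moment :: "nat \<Rightarrow> real \<Rightarrow> real" where
  "moment m y = (\<integral>t. s t powr y * ln (s t) ^ m \<partial>M)"

text \<open>Each factor ln s costs at most s^(-d) / d. With d half the distance from y to -1, the
  lowered exponent y - d is still above -1, so the induction on m goes through.\<close>

lemma integrable_moment:
  "y > -1 \<Longrightarrow> integrable M (\<lambda>t. s t powr y * ln (s t) ^ m)"
proof (induction m arbitrary: y)
  case 0
  then show ?case by (simp add: integrable_powr)
next
  case (Suc m)
  define d where "d = (y + 1) / 2"
  have d: "d > 0" "y - d > -1"
    using Suc.prems by (auto simp: d_def field_simps)
  have "integrable M (\<lambda>t. 1 / d * (s t powr (y - d) * ln (s t) ^ m))"
    using Suc.IH[OF d(2)] by (intro integrable_mult_right) auto
  then show ?case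
  proof (rule Bochner_Integration.integrable_bound)
    show "AE t in M. norm (s t powr y * ln (s t) ^ Suc m)
        \<le> norm (1 / d * (s t powr (y - d) * ln (s t) ^ m))"
    proof (rule AE_I2)
      fix t assume t: "t \<in> space M"
      have "\<bar>ln (s t)\<bar> \<le> s t powr (- d) / d"
        using neg_ln_le_powr[OF s_pos[OF t] d(1)] s_pos[OF t] s_less_1[OF t]
        by simp
      then have "s t powr y * \<bar>ln (s t)\<bar> ^ m * \<bar>ln (s t)\<bar>
          \<le> s t powr y * \<bar>ln (s t)\<bar> ^ m * (s t powr (- d) / d)"
        by (intro mult_left_mono) auto
      also have "\<dots> = 1 / d * ((s t powr y * s t powr (- d)) * \<bar>ln (s t)\<bar> ^ m)"
        by simp
      also have "s t powr y * s t powr (- d) = s t powr (y - d)"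
        by (simp add: powr_add [symmetric])
      finally show "norm (s t powr y * ln (s t) ^ Suc m)
          \<le> norm (1 / d * (s t powr (y - d) * ln (s t) ^ m))"
        using d by (simp add: abs_mult power_abs mult_ac)
    qed
  qed measurable
qed

text \<open>Differentiation under the integral sign with an explicit remainder: the error of the
  linear approximation is at most h^2 * C, so the difference quotient is within |h| * C of the
  claimed value.\<close>

lemma moment_has_derivative:
  assumes "y > -1"
  shows "(moment m has_real_derivative moment (Suc m) y) (at y)"
proof -
  define d where "d = (y + 1) / 2"
  have d: "d > 0" "y - d > -1"
    using assms by (auto simp: d_def field_simps)
  \<comment> \<open>Two extra logarithms come from (h ln s)^2; lowering the exponent by d absorbs
    exp |h ln s| for all |h| <= d.\<close>
  define C where "C = (\<integral>t. s t powr (y - d) * \<bar>ln (s t) ^ (m + 2)\<bar> \<partial>M)"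
  have int_C: "integrable M (\<lambda>t. s t powr (y - d) * \<bar>ln (s t) ^ (m + 2)\<bar>)"
    using integrable_norm[OF integrable_moment[OF d(2), of "m + 2"]]
    by (simp add: abs_mult del: power_Suc)
  have bound: "\<bar>moment m (y + h) - moment m y - h * moment (Suc m) y\<bar> \<le> h\<^sup>2 * C"
    if h: "\<bar>h\<bar> \<le> d" for h
  proof -
    have yh: "y + h > -1" using h d by auto
    note ints = integrable_moment[OF yh, of m] integrable_moment[OF assms, of m]
      integrable_moment[OF assms, of "Suc m"]
    let ?D = "\<lambda>t. s t powr (y + h) * ln (s t) ^ m - s t powr y * ln (s t) ^ m
        - h * (s t powr y * ln (s t) ^ Suc m)"
    have int_h: "integrable M (\<lambda>t. h * (s t powr y * ln (s t) ^ Suc m))"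
      using ints(3) by (rule integrable_mult_right)
    have int_D: "integrable M ?D"
      using ints(1,2) int_h by (intro Bochner_Integration.integrable_diff)
    have eq: "moment m (y + h) - moment m y - h * moment (Suc m) y = (\<integral>t. ?D t \<partial>M)"
      unfolding moment_def using ints by (simp del: power_Suc)
    have "\<bar>\<integral>t. ?D t \<partial>M\<bar> \<le> (\<integral>t. \<bar>?D t\<bar> \<partial>M)"
      by (rule integral_abs_bound)
    also have "\<dots> \<le> (\<integral>t. h\<^sup>2 * (s t powr (y - d) * \<bar>ln (s t) ^ (m + 2)\<bar>) \<partial>M)"
    proof (rule integral_mono)
      show "integrable M (\<lambda>t. \<bar>?D t\<bar>)"
        using int_D by (rule integrable_abs)
      show "integrable M (\<lambda>t. h\<^sup>2 * (s t powr (y - d) * \<bar>ln (s t) ^ (m + 2)\<bar>))"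
        using int_C by (rule integrable_mult_right)
    next
      fix t assume t: "t \<in> space M"
      define l where "l = ln (s t)"
      have st: "0 < s t" "s t < 1" using s_pos[OF t] s_less_1[OF t] by auto
      have pw: "s t powr z = exp (z * l)" for z
        using st by (simp add: powr_def l_def)
      have l: "l < 0" using st by (simp add: l_def)
      have "?D t = exp (y * l) * l ^ m * (exp (h * l) - 1 - h * l)"
        by (simp add: pw l_def [symmetric] exp_add algebra_simps)
      then have "\<bar>?D t\<bar> = exp (y * l) * \<bar>l\<bar> ^ m * \<bar>exp (h * l) - 1 - h * l\<bar>"
        by (simp add: abs_mult power_abs)
      also have "\<dots> \<le> exp (y * l) * \<bar>l\<bar> ^ m * ((h * l)\<^sup>2 * exp \<bar>h * l\<bar>)"
        by (intro mult_left_mono exp_minus_one_minus_le) auto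
      also have "\<dots> \<le> exp (y * l) * \<bar>l\<bar> ^ m * ((h * l)\<^sup>2 * exp (- d * l))"
      proof -
        have "\<bar>h\<bar> * \<bar>l\<bar> \<le> d * \<bar>l\<bar>"
          using h by (intro mult_right_mono) auto
        then show ?thesis
          using l by (intro mult_left_mono) (auto simp: abs_mult)
      qed
      also have "\<dots> = h\<^sup>2 * ((exp (y * l) * exp (- d * l)) * (\<bar>l\<bar> ^ m * l\<^sup>2))"
        by (simp add: power_mult_distrib)
      also have "exp (y * l) * exp (- d * l) = exp ((y - d) * l)"
        by (simp add: mult_exp_exp algebra_simps)
      also have "\<bar>l\<bar> ^ m * l\<^sup>2 = \<bar>l ^ (m + 2)\<bar>"
        by (simp add: power_add power_abs abs_mult power2_eq_square)
      finally show "\<bar>?D t\<bar> \<le> h\<^sup>2 * (s t powr (y - d) * \<bar>ln (s t) ^ (m + 2)\<bar>)"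
        by (simp add: pw l_def)
    qed
    also have "\<dots> = h\<^sup>2 * C"
      by (simp add: C_def)
    finally show ?thesis
      unfolding eq .
  qed
  have "((\<lambda>h. (moment m (y + h) - moment m y) / h - moment (Suc m) y) \<longlongrightarrow> 0) (at 0)"
  proof (rule Lim_null_comparison)
    show "\<forall>\<^sub>F h in at 0. norm ((moment m (y + h) - moment m y) / h - moment (Suc m) y) \<le> \<bar>h\<bar> * C"
      unfolding eventually_at
    proof (intro exI[of _ d] conjI ballI impI)
      fix h :: real assume "h \<noteq> 0 \<and> dist h 0 < d"
      then have h: "h \<noteq> 0" "\<bar>h\<bar> \<le> d" by auto
      have "norm ((moment m (y + h) - moment m y) / h - moment (Suc m) y)
          = \<bar>moment m (y + h) - moment m y - h * moment (Suc m) y\<bar> / \<bar>h\<bar>"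
        using h by (simp add: field_simps flip: abs_divide)
      also have "\<dots> \<le> h\<^sup>2 * C / \<bar>h\<bar>"
        using bound[OF h(2)] by (rule divide_right_mono) auto
      also have "\<dots> = \<bar>h\<bar> * C"
        using h by (simp add: field_simps power2_eq_square)
      finally show "norm ((moment m (y + h) - moment m y) / h - moment (Suc m) y) \<le> \<bar>h\<bar> * C" .
    qed (use d in auto)
    show "((\<lambda>h. \<bar>h\<bar> * C) \<longlongrightarrow> 0) (at 0)"
      by (auto intro!: tendsto_eq_intros)
  qed
  then show ?thesis
    unfolding DERIV_def by (simp add: LIM_zero_iff)
qed

end

section \<open>Integrals over the unit interval\<close>

text \<open>On the open interval the strict bounds demanded by \<open>log_moments\<close> hold at
  every point of the space.\<close>

definition unit_measure :: "real measure" where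
  "unit_measure = restrict_space lborel {0<..<1}"

lemma space_unit_measure [simp]: "space unit_measure = {0<..<1}"
  by (simp add: unit_measure_def space_restrict_space)

lemma measurable_unit_measureI [measurable (raw)]:
  "f \<in> borel_measurable borel \<Longrightarrow> f \<in> borel_measurable unit_measure"
  unfolding unit_measure_def by (rule measurable_restrict_space1) simp

lemma integrable_unit_measure_iff:
  fixes f :: "real \<Rightarrow> 'a :: {banach, second_countable_topology}"
  shows "integrable unit_measure f \<longleftrightarrow> set_integrable lborel {0<..<1} f"
  unfolding unit_measure_def set_integrable_def by (rule integrable_restrict_space) simp

lemma integrable_unit_measureI:
  fixes f :: "real \<Rightarrow> 'a :: {banach, second_countable_topology}"
  assumes "set_integrable lborel {0..1} f"
  shows "integrable unit_measure f"
  unfolding integrable_unit_measure_iff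
  using assms by (rule set_integrable_subset) auto

text \<open>The endpoints are a null set, so results stated on the closed interval become
  available.\<close>

lemma integral_unit_measure:
  fixes f :: "real \<Rightarrow> 'a :: {banach, second_countable_topology}"
  shows "integral\<^sup>L unit_measure f = (LBINT x:{0..1}. f x)"
proof -
  have "integral\<^sup>L unit_measure f = (\<integral>x. indicator {0<..<1} x *\<^sub>R f x \<partial>lborel)"
    unfolding unit_measure_def by (rule integral_restrict_space) simp
  also have "\<dots> = (\<integral>x. indicator {0..1} x *\<^sub>R f x \<partial>lborel)"
  proof (rule integral_discrete_difference[of "{0, 1}"])
    show "indicator {0<..<1} x *\<^sub>R f x = indicator {0..1} x *\<^sub>R f x"
      if "x \<notin> {0, 1}" for x :: real
      using that by (auto simp: indicator_def)
  qed auto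
  finally show ?thesis
    by (simp add: set_lebesgue_integral_def)
qed

lemma integral_unit_measure_FTC:
  fixes f :: "real \<Rightarrow> 'a :: euclidean_space"
  assumes "\<And>x. 0 \<le> x \<Longrightarrow> x \<le> 1 \<Longrightarrow> (F has_vector_derivative f x) (at x within {0..1})"
    and "continuous_on {0..1} f"
  shows "integral\<^sup>L unit_measure f = F 1 - F 0"
  unfolding integral_unit_measure set_lebesgue_integral_def
  using assms by (intro integral_FTC_atLeastAtMost) auto

lemma integral_unit_measure_reflect:
  fixes f :: "real \<Rightarrow> real"
  shows "(\<integral>t. f (1 - t) \<partial>unit_measure) = (\<integral>t. f t \<partial>unit_measure)"
proof -
  have "(\<integral>t. f t \<partial>unit_measure) = (\<integral>x. indicator {0..1} x *\<^sub>R f x \<partial>lborel)"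
    by (simp add: integral_unit_measure set_lebesgue_integral_def)
  also have "\<dots> = (\<integral>x. indicator {0..1} (1 - x) *\<^sub>R f (1 - x) \<partial>lborel)"
    by (subst lborel_integral_real_affine[where c = "-1" and t = 1]) auto
  also have "\<dots> = (\<integral>x. indicator {0..1} x *\<^sub>R f (1 - x) \<partial>lborel)"
    by (intro Bochner_Integration.integral_cong) (auto simp: indicator_def)
  finally show ?thesis
    by (simp add: integral_unit_measure set_lebesgue_integral_def)
qed

section \<open>Beta integrals and closed forms of the moments\<close>

lemma Beta_integral_unit_measure:
  assumes "a > 0" "b > 0"
  shows "integrable unit_measure (\<lambda>t. t powr (a - 1) * (1 - t) powr (b - 1))"
    and "(\<integral>t. t powr (a - 1) * (1 - t) powr (b - 1) \<partial>unit_measure) = Beta a b"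
proof -
  note int = integrable_Beta[OF assms]
  show "integrable unit_measure (\<lambda>t. t powr (a - 1) * (1 - t) powr (b - 1))"
    using int by (rule integrable_unit_measureI)
  show "(\<integral>t. t powr (a - 1) * (1 - t) powr (b - 1) \<partial>unit_measure) = Beta a b"
    unfolding integral_unit_measure set_borel_integral_eq_integral(2)[OF int]
    using has_integral_Beta_real[OF assms] by (rule integral_unique)
qed

interpretation pow: log_moments unit_measure "\<lambda>t. t"
proof
  fix c :: real assume "c > -1"
  then have "integrable unit_measure (\<lambda>t. t powr c * (1 - t) powr 0)"
    using Beta_integral_unit_measure(1)[of "c + 1" 1] by simp
  then show "integrable unit_measure (\<lambda>t. t powr c)"
    by (rule Bochner_Integration.integrable_cong[THEN iffD1, rotated -1]) auto
qed auto

interpretation beta: log_moments unit_measure "\<lambda>t. t * (1 - t)"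
proof
  fix c :: real assume "c > -1"
  then have "integrable unit_measure (\<lambda>t. t powr c * (1 - t) powr c)"
    using Beta_integral_unit_measure(1)[of "c + 1" "c + 1"] by simp
  then show "integrable unit_measure (\<lambda>t. (t * (1 - t)) powr c)"
    by (rule Bochner_Integration.integrable_cong[THEN iffD1, rotated -1]) (auto simp: powr_mult)
next
  fix t assume "t \<in> space unit_measure"
  then show "0 < t * (1 - t)" "t * (1 - t) < 1"
    using mult_strict_mono[of t 1 "1 - t" 1] by auto
qed auto

lemma pow_moment_0:
  assumes "y > -1"
  shows "pow.moment 0 y = 1 / (y + 1)"
proof -
  have "pow.moment 0 y = (\<integral>t. t powr (y + 1 - 1) * (1 - t) powr (1 - 1) \<partial>unit_measure)"
    unfolding pow.moment_def by (rule Bochner_Integration.integral_cong) auto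
  also have "\<dots> = Beta (y + 1) 1"
    using assms by (intro Beta_integral_unit_measure) auto
  also have "\<dots> = 1 / (y + 1)"
  proof -
    have "y + 1 \<notin> \<int>\<^sub>\<le>\<^sub>0"
      using assms by (auto elim!: nonpos_Ints_cases)
    then have "Gamma (y + 1 + 1) = (y + 1) * Gamma (y + 1)"
      by (rule Gamma_plus1)
    moreover have "Gamma (y + 1) > 0"
      using assms by (intro Gamma_real_pos) auto
    ultimately show ?thesis
      by (simp add: Beta_def)
  qed
  finally show ?thesis .
qed

text \<open>Successive moments are derivatives of each other in y, so the formula arises by
  differentiating 1 / (y + 1) m times; uniqueness of the derivative carries it from m to m +
  1.\<close>

lemma pow_moment:
  assumes "y > -1"
  shows "pow.moment m y = (- 1) ^ m * fact m / (y + 1) ^ Suc m"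
  using assms
proof (induction m arbitrary: y)
  case 0
  then show ?case by (simp add: pow_moment_0)
next
  case (Suc m)
  have "((\<lambda>y. (- 1) ^ m * fact m / (y + 1) ^ Suc m) has_real_derivative
      - ((- 1) ^ m * fact m) * (real (Suc m) * (y + 1) ^ m) / ((y + 1) ^ Suc m)\<^sup>2) (at y)"
    using Suc.prems by (auto intro!: derivative_eq_intros simp: power2_eq_square simp del: power_Suc)
  moreover have "- ((- 1) ^ m * fact m) * (real (Suc m) * (y + 1) ^ m) / ((y + 1) ^ Suc m)\<^sup>2
      = (- 1) ^ Suc m * fact (Suc m) / (y + 1) ^ Suc (Suc m)"
  proof -
    define a where "a = y + 1"
    have "a \<noteq> 0" using Suc.prems by (simp add: a_def)
    then show ?thesis
      unfolding a_def [symmetric] by (simp add: field_simps power2_eq_square)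
  qed
  ultimately have deriv: "((\<lambda>y. (- 1) ^ m * fact m / (y + 1) ^ Suc m) has_real_derivative
      (- 1) ^ Suc m * fact (Suc m) / (y + 1) ^ Suc (Suc m)) (at y)"
    by simp
  have "eventually (\<lambda>z. z \<in> {-1<..}) (nhds y)"
    using Suc.prems by (intro eventually_nhds_in_open) auto
  then have "eventually (\<lambda>z. pow.moment m z = (- 1) ^ m * fact m / (z + 1) ^ Suc m) (nhds y)"
    by eventually_elim (use Suc.IH in auto)
  from DERIV_cong_ev[OF refl this refl] deriv
  have "(pow.moment m has_real_derivative (- 1) ^ Suc m * fact (Suc m) / (y + 1) ^ Suc (Suc m)) (at y)"
    by blast
  then show ?case
    using pow.moment_has_derivative[OF Suc.prems] DERIV_unique by blast
qed

lemma beta_moment_0: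
  assumes "y > -1"
  shows "beta.moment 0 y = Beta (y + 1) (y + 1)"
proof -
  have "beta.moment 0 y = (\<integral>t. t powr (y + 1 - 1) * (1 - t) powr (y + 1 - 1) \<partial>unit_measure)"
    unfolding beta.moment_def by (rule Bochner_Integration.integral_cong) (auto simp: powr_mult)
  also have "\<dots> = Beta (y + 1) (y + 1)"
    using assms by (intro Beta_integral_unit_measure) auto
  finally show ?thesis .
qed

section \<open>Geometric series under the integral sign\<close>

lemma mult_one_minus_le: "t * (1 - t) \<le> 1 / 4" for t :: real
  using zero_le_power2[of "t - 1 / 2"] by (simp add: power2_eq_square algebra_simps)

lemma one_minus_mult_ge: "3 / 4 \<le> 1 - t + t\<^sup>2" for t :: real
  using mult_one_minus_le[of t] by (simp add: power2_eq_square algebra_simps)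

definition log_integral :: "nat \<Rightarrow> real" where
  "log_integral m = (\<integral>t. ln t ^ m / (1 - t + t\<^sup>2) \<partial>unit_measure)"

text \<open>This is the integral I_m.\<close>

definition beta_log_integral :: "nat \<Rightarrow> real" where
  "beta_log_integral m = (\<integral>t. ln (t * (1 - t)) ^ m / (1 - t + t\<^sup>2) \<partial>unit_measure)"

lemma integrable_beta_log: "integrable unit_measure (\<lambda>t. ln (t * (1 - t)) ^ m / (1 - t + t\<^sup>2))"
proof (rule Bochner_Integration.integrable_bound)
  show "integrable unit_measure (\<lambda>t. 4 / 3 * ((t * (1 - t)) powr 0 * ln (t * (1 - t)) ^ m))"
    using beta.integrable_moment[of 0 m] by (intro integrable_mult_right) auto
  show "AE t in unit_measure. norm (ln (t * (1 - t)) ^ m / (1 - t + t\<^sup>2))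
      \<le> norm (4 / 3 * ((t * (1 - t)) powr 0 * ln (t * (1 - t)) ^ m))"
  proof (rule AE_I2)
    fix t assume t: "t \<in> space unit_measure"
    have inv: "1 / (1 - t + t\<^sup>2) \<le> 4 / 3" and pos: "0 < 1 - t + t\<^sup>2"
      using one_minus_mult_ge[of t] by (auto simp: field_simps)
    have "\<bar>ln (t * (1 - t)) ^ m\<bar> * (1 / (1 - t + t\<^sup>2)) \<le> \<bar>ln (t * (1 - t)) ^ m\<bar> * (4 / 3)"
      using inv by (intro mult_left_mono) auto
    then show "norm (ln (t * (1 - t)) ^ m / (1 - t + t\<^sup>2))
        \<le> norm (4 / 3 * ((t * (1 - t)) powr 0 * ln (t * (1 - t)) ^ m))"
      using t pos by (simp add: abs_mult)
  qed
qed measurable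

text \<open>On (0,1) both logarithms are negative, so each is bounded in absolute value by their sum
  ln (t(1-t)).\<close>

lemma integrable_ln_powers:
  "integrable unit_measure (\<lambda>t. ln t ^ i * ln (1 - t) ^ j / (1 - t + t\<^sup>2))"
proof (rule Bochner_Integration.integrable_bound[OF integrable_beta_log[of "i + j"]])
  show "AE t in unit_measure. norm (ln t ^ i * ln (1 - t) ^ j / (1 - t + t\<^sup>2))
      \<le> norm (ln (t * (1 - t)) ^ (i + j) / (1 - t + t\<^sup>2))"
  proof (rule AE_I2)
    fix t assume "t \<in> space unit_measure"
    then have t: "0 < t" "t < 1" by auto
    have l: "\<bar>ln (t * (1 - t))\<bar> = \<bar>ln t\<bar> + \<bar>ln (1 - t)\<bar>"
      using t abs_of_neg[OF add_neg_neg, of "ln t" "ln (1 - t)"] by (simp add: ln_mult)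
    have "\<bar>ln t\<bar> ^ i * \<bar>ln (1 - t)\<bar> ^ j \<le> \<bar>ln (t * (1 - t))\<bar> ^ i * \<bar>ln (t * (1 - t))\<bar> ^ j"
      by (intro mult_mono power_mono) (simp_all add: l)
    then show "norm (ln t ^ i * ln (1 - t) ^ j / (1 - t + t\<^sup>2))
        \<le> norm (ln (t * (1 - t)) ^ (i + j) / (1 - t + t\<^sup>2))"
      using one_minus_mult_ge[of t] unfolding norm_divide
      by (intro divide_right_mono) (simp_all add: abs_mult power_abs power_add)
  qed
qed measurable

text \<open>With s = t(1-t) the denominator is 1 - s, and the geometric series truncated after N
  terms leaves s^N / (1 - s). Since s <= 1/4, this is at most 4/3 * (1/4)^N uniformly in t.\<close>

lemma beta_moments_sums: "(\<lambda>n. beta.moment m (real n)) sums beta_log_integral m"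
proof -
  let ?s = "\<lambda>t::real. t * (1 - t)"
  define C where "C = (\<integral>t. \<bar>?s t powr 0 * ln (?s t) ^ m\<bar> \<partial>unit_measure)"
  have int_C: "integrable unit_measure (\<lambda>t. \<bar>?s t powr 0 * ln (?s t) ^ m\<bar>)"
    using beta.integrable_moment[of 0 m] by (intro integrable_abs) auto
  have s: "0 < ?s t" "?s t \<le> 1 / 4" "1 - t + t\<^sup>2 = 1 - ?s t" if "t \<in> space unit_measure" for t
    using that mult_one_minus_le by (auto simp: power2_eq_square algebra_simps)
  note int_lim = integrable_beta_log[of m]
  have rem: "\<bar>beta_log_integral m - (\<Sum>n<N. beta.moment m (real n))\<bar> \<le> 4 / 3 * C * (1 / 4) ^ N" for N
  proof -
    have int: "integrable unit_measure (\<lambda>t. ?s t powr real n * ln (?s t) ^ m)" for n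
      by (rule beta.integrable_moment) auto
    have int_sum: "integrable unit_measure (\<lambda>t. \<Sum>n<N. ?s t powr real n * ln (?s t) ^ m)"
      using int by (intro Bochner_Integration.integrable_sum)
    let ?R = "\<lambda>t. ln (?s t) ^ m / (1 - t + t\<^sup>2) - (\<Sum>n<N. ?s t powr real n * ln (?s t) ^ m)"
    have eq: "beta_log_integral m - (\<Sum>n<N. beta.moment m (real n)) = (\<integral>t. ?R t \<partial>unit_measure)"
      unfolding beta_log_integral_def beta.moment_def
      by (subst Bochner_Integration.integral_diff[OF int_lim int_sum],
          subst Bochner_Integration.integral_sum[OF int]) simp
    have "\<bar>\<integral>t. ?R t \<partial>unit_measure\<bar> \<le> (\<integral>t. \<bar>?R t\<bar> \<partial>unit_measure)"
      by (rule integral_abs_bound)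
    also have "\<dots> \<le> (\<integral>t. (4 / 3 * (1 / 4) ^ N) * \<bar>?s t powr 0 * ln (?s t) ^ m\<bar> \<partial>unit_measure)"
    proof (rule integral_mono)
      show "integrable unit_measure (\<lambda>t. \<bar>?R t\<bar>)"
        using int_lim int_sum by (intro integrable_abs Bochner_Integration.integrable_diff)
      show "integrable unit_measure (\<lambda>t. (4 / 3 * (1 / 4) ^ N) * \<bar>?s t powr 0 * ln (?s t) ^ m\<bar>)"
        using int_C by (rule integrable_mult_right)
    next
      fix t assume t: "t \<in> space unit_measure"
      define u where "u = ?s t"
      have u: "0 < u" "u \<le> 1 / 4" "1 - t + t\<^sup>2 = 1 - u"
        using s[OF t] by (auto simp: u_def)
      have "(\<Sum>n<N. u powr real n * ln u ^ m) = (\<Sum>n<N. u ^ n) * ln u ^ m"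
        using u by (simp add: powr_realpow sum_distrib_right)
      also have "(\<Sum>n<N. u ^ n) = (1 - u ^ N) / (1 - u)"
        using u by (subst geometric_sum) (auto simp: field_simps)
      finally have "?R t = ln u ^ m / (1 - u) - (1 - u ^ N) / (1 - u) * ln u ^ m"
        using u(3) by (simp add: u_def)
      also have "\<dots> = ln u ^ m * u ^ N * (1 / (1 - u))"
        by (simp add: diff_divide_distrib algebra_simps)
      finally have R_eq: "?R t = ln u ^ m * u ^ N * (1 / (1 - u))" .
      have "\<bar>?R t\<bar> = \<bar>ln u ^ m\<bar> * u ^ N * (1 / (1 - u))"
        unfolding R_eq using u by (simp add: abs_mult)
      also have "\<dots> \<le> \<bar>ln u ^ m\<bar> * (1 / 4) ^ N * (4 / 3)"
        using u by (intro mult_mono power_mono) (auto simp: field_simps)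
      finally have "\<bar>?R t\<bar> \<le> (4 / 3 * (1 / 4) ^ N) * \<bar>u powr 0 * ln u ^ m\<bar>"
        using u(1) by (simp only: powr_zero_eq_one less_imp_neq[symmetric] if_False mult_1 mult_ac)
      then show "\<bar>?R t\<bar> \<le> (4 / 3 * (1 / 4) ^ N) * \<bar>?s t powr 0 * ln (?s t) ^ m\<bar>"
        by (simp only: u_def)
    qed
    also have "\<dots> = 4 / 3 * C * (1 / 4) ^ N"
      by (simp add: C_def)
    finally show ?thesis
      unfolding eq .
  qed
  have "(\<lambda>N. beta_log_integral m - (\<Sum>n<N. beta.moment m (real n))) \<longlonglongrightarrow> 0"
  proof (rule Lim_null_comparison)
    show "(\<lambda>N. 4 / 3 * C * (1 / 4) ^ N) \<longlonglongrightarrow> 0"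
      by (intro tendsto_mult_right_zero LIMSEQ_realpow_zero) auto
  qed (use rem in auto)
  then show ?thesis
    unfolding sums_def using tendsto_diff[OF tendsto_const[of "beta_log_integral m"]] by fastforce
qed

lemma abs_pow_moment_eq:
  assumes "y > -1"
  shows "(\<integral>t. \<bar>t powr y * ln t ^ m\<bar> \<partial>unit_measure) = fact m / (y + 1) ^ Suc m"
proof -
  have "(\<integral>t. \<bar>t powr y * ln t ^ m\<bar> \<partial>unit_measure)
      = (\<integral>t. (- 1) ^ m * (t powr y * ln t ^ m) \<partial>unit_measure)"
  proof (rule Bochner_Integration.integral_cong)
    fix t assume "t \<in> space unit_measure"
    then have "\<bar>ln t\<bar> = - 1 * ln t" by auto
    then have "\<bar>ln t\<bar> ^ m = (- 1) ^ m * ln t ^ m"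
      by (simp only: power_mult_distrib)
    then show "\<bar>t powr y * ln t ^ m\<bar> = (- 1) ^ m * (t powr y * ln t ^ m)"
      by (simp add: abs_mult power_abs)
  qed simp
  also have "\<dots> = (- 1) ^ m * pow.moment m y"
    by (simp add: pow.moment_def)
  also have "\<dots> = fact m / (y + 1) ^ Suc m"
    unfolding pow_moment[OF assms] by (simp flip: power_add mult.assoc add: mult_2[symmetric])
  finally show ?thesis .
qed

text \<open>Expand (1 + t) / (1 + t^3) = 1 / (1 - t + t^2) in powers of -t^3. The remainder after N
  terms is (-t^3)^N / (1 - t + t^2), so its integral against ln^m t is at most 4/3 times an absolute
  moment that tends to 0 like a power of 1/N.\<close>

lemma alternating_pow_moments_sums:
  "(\<lambda>n. (- 1) ^ n * (pow.moment m (3 * real n) + pow.moment m (3 * real n + 1))) sums log_integral m"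
proof -
  have rem: "\<bar>log_integral m - (\<Sum>n<N. (- 1) ^ n * (pow.moment m (3 * real n) + pow.moment m (3 * real n + 1)))\<bar>
      \<le> 4 / 3 * (fact m / (3 * real N + 1) ^ Suc m)" for N
  proof -
    let ?T = "\<lambda>n t. (- 1) ^ n * (t powr (3 * real n) * ln t ^ m + t powr (3 * real n + 1) * ln t ^ m)"
    let ?I = "\<lambda>t. ln t ^ m / (1 - t + t\<^sup>2)"
    have int: "integrable unit_measure (?T n)" for n
      by (intro integrable_mult_right Bochner_Integration.integrable_add pow.integrable_moment) auto
    have int_sum: "integrable unit_measure (\<lambda>t. \<Sum>n<N. ?T n t)"
      using int by (intro Bochner_Integration.integrable_sum)
    have int_I: "integrable unit_measure ?I"
      using integrable_ln_powers[of m 0] by simp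
    have moments_eq: "(- 1) ^ n * (pow.moment m (3 * real n) + pow.moment m (3 * real n + 1))
        = (\<integral>t. ?T n t \<partial>unit_measure)" for n
      unfolding pow.moment_def by (simp add: pow.integrable_moment)
    have eq: "log_integral m - (\<Sum>n<N. (- 1) ^ n * (pow.moment m (3 * real n) + pow.moment m (3 * real n + 1)))
        = (\<integral>t. ?I t - (\<Sum>n<N. ?T n t) \<partial>unit_measure)"
      unfolding moments_eq log_integral_def
      by (subst Bochner_Integration.integral_diff[OF int_I int_sum],
          subst Bochner_Integration.integral_sum[OF int]) simp
    have int_N: "integrable unit_measure (\<lambda>t. 4 / 3 * \<bar>t powr (3 * real N) * ln t ^ m\<bar>)"
      by (intro integrable_mult_right integrable_abs pow.integrable_moment) auto
    have "\<bar>\<integral>t. ?I t - (\<Sum>n<N. ?T n t) \<partial>unit_measure\<bar>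
        \<le> (\<integral>t. \<bar>?I t - (\<Sum>n<N. ?T n t)\<bar> \<partial>unit_measure)"
      by (rule integral_abs_bound)
    also have "\<dots> \<le> (\<integral>t. 4 / 3 * \<bar>t powr (3 * real N) * ln t ^ m\<bar> \<partial>unit_measure)"
    proof (rule integral_mono)
      show "integrable unit_measure (\<lambda>t. \<bar>?I t - (\<Sum>n<N. ?T n t)\<bar>)"
        using int_I int_sum by (intro integrable_abs Bochner_Integration.integrable_diff)
    next
      fix t assume "t \<in> space unit_measure"
      then have t: "0 < t" "t < 1" by auto
      have pos: "0 < 1 - t + t\<^sup>2" and inv: "1 / (1 - t + t\<^sup>2) \<le> 4 / 3"
        using one_minus_mult_ge[of t] by (auto simp: field_simps)
      have pw: "t powr (3 * real n) = (t ^ 3) ^ n" for n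
        using powr_realpow[OF t(1), of "3 * n"] by (simp add: power_mult)
      have pw1: "t powr (3 * real n + 1) = (t ^ 3) ^ n * t" for n
        using t by (simp add: powr_add pw)
      have "?T n t = (- (t ^ 3)) ^ n * ((1 + t) * ln t ^ m)" for n
        unfolding pw pw1 power_minus[of "t ^ 3"] by (simp add: algebra_simps)
      then have "(\<Sum>n<N. ?T n t) = (\<Sum>n<N. (- (t ^ 3)) ^ n) * ((1 + t) * ln t ^ m)"
        by (simp add: sum_distrib_right)
      also have "(\<Sum>n<N. (- (t ^ 3)) ^ n) = (1 - (- (t ^ 3)) ^ N) / (1 + t ^ 3)"
      proof -
        have "t ^ 3 > 0" using t by simp
        then have "t ^ 3 \<noteq> - 1" by linarith
        then show ?thesis
          by (subst geometric_sum) (auto simp: divide_simps, auto simp: algebra_simps)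
      qed
      also have "1 + t ^ 3 = (1 + t) * (1 - t + t\<^sup>2)"
        by (simp add: power2_eq_square power3_eq_cube algebra_simps)
      also have "(1 - (- (t ^ 3)) ^ N) / ((1 + t) * (1 - t + t\<^sup>2)) * ((1 + t) * ln t ^ m)
          = (1 - (- (t ^ 3)) ^ N) * ?I t"
        using t by simp
      finally have "?I t - (\<Sum>n<N. ?T n t) = (- (t ^ 3)) ^ N * ln t ^ m * (1 / (1 - t + t\<^sup>2))"
        by (simp add: diff_divide_distrib left_diff_distrib)
      then have "\<bar>?I t - (\<Sum>n<N. ?T n t)\<bar> = \<bar>t powr (3 * real N) * ln t ^ m\<bar> * (1 / (1 - t + t\<^sup>2))"
        using t pos by (simp add: abs_mult power_abs pw)
      also have "\<dots> \<le> \<bar>t powr (3 * real N) * ln t ^ m\<bar> * (4 / 3)"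
        using inv by (rule mult_left_mono) auto
      finally show "\<bar>?I t - (\<Sum>n<N. ?T n t)\<bar> \<le> 4 / 3 * \<bar>t powr (3 * real N) * ln t ^ m\<bar>"
        by (simp add: mult.commute)
    qed (rule int_N)
    also have "\<dots> = 4 / 3 * (fact m / (3 * real N + 1) ^ Suc m)"
      by (subst integral_mult_right_zero, subst abs_pow_moment_eq) auto
    finally show ?thesis
      unfolding eq .
  qed
  have "(\<lambda>N. log_integral m - (\<Sum>n<N. (- 1) ^ n * (pow.moment m (3 * real n) + pow.moment m (3 * real n + 1))))
      \<longlonglongrightarrow> 0"
  proof (rule Lim_null_comparison)
    show "(\<lambda>N. 4 / 3 * fact m * inverse (real (Suc N))) \<longlonglongrightarrow> 0"
      by (intro tendsto_mult_right_zero LIMSEQ_inverse_real_of_nat)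
    show "\<forall>\<^sub>F N in sequentially. norm (log_integral m
        - (\<Sum>n<N. (- 1) ^ n * (pow.moment m (3 * real n) + pow.moment m (3 * real n + 1))))
        \<le> 4 / 3 * fact m * inverse (real (Suc N))"
    proof (intro always_eventually allI)
      fix N
      have "real (Suc N) * 1 \<le> (3 * real N + 1) * (3 * real N + 1) ^ m"
        by (intro mult_mono one_le_power) auto
      then have "4 / 3 * (fact m / (3 * real N + 1) ^ Suc m) \<le> 4 / 3 * (fact m / real (Suc N))"
        by (intro mult_left_mono divide_left_mono) auto
      with rem[of N] show "norm (log_integral m
          - (\<Sum>n<N. (- 1) ^ n * (pow.moment m (3 * real n) + pow.moment m (3 * real n + 1))))
          \<le> 4 / 3 * fact m * inverse (real (Suc N))"
        by (simp add: inverse_eq_divide)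
    qed
  qed
  then show ?thesis
    unfolding sums_def using tendsto_diff[OF tendsto_const[of "log_integral m"]] by fastforce
qed

section \<open>The L-values as logarithmic integrals\<close>

lemma L_minus3_sums:
  assumes "s \<ge> 2"
  shows "(\<lambda>n. 1 / (3 * real n + 1) ^ s - 1 / (3 * real n + 2) ^ s) sums L_minus3 s"
proof -
  have "summable (\<lambda>n. inverse (real (Suc n) ^ s))"
    using inverse_power_summable[OF assms, where 'a = real] by (subst summable_Suc_iff)
  then have "summable (\<lambda>n. 1 / (3 * real n + 1) ^ s - 1 / (3 * real n + 2) ^ s)"
  proof (rule summable_comparison_test'[where N = 0])
    fix n
    have "1 / (3 * real n + 2) ^ s \<le> 1 / (3 * real n + 1) ^ s"
      by (intro divide_left_mono power_mono) auto
    moreover have "1 / (3 * real n + 1) ^ s \<le> 1 / real (Suc n) ^ s"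
      by (intro divide_left_mono power_mono) auto
    moreover have "0 \<le> 1 / (3 * real n + 2) ^ s"
      by simp
    ultimately have "\<bar>1 / (3 * real n + 1) ^ s - 1 / (3 * real n + 2) ^ s\<bar> \<le> 1 / real (Suc n) ^ s"
      by linarith
    then show "norm (1 / (3 * real n + 1) ^ s - 1 / (3 * real n + 2) ^ s) \<le> inverse (real (Suc n) ^ s)"
      by (simp add: inverse_eq_divide)
  qed
  then show ?thesis
    unfolding L_minus3_def by (rule summable_sums)
qed

text \<open>The moments give the series d with signs +, +, -, - on the residues 1, 2, 4, 5 mod 6,
  whereas the L-series c has signs +, -, +, -. They differ by twice the even terms, and extracting
  2^s from these reproduces c; hence the factor 1 + 2 / 2^s with s = m + 1. Both series are grouped
  in pairs to compare them.\<close>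

lemma log_integral_eq_L_minus3:
  assumes "m \<ge> 1"
  shows "log_integral m = (- 1) ^ m * fact m * (1 + 2 / 2 ^ Suc m) * L_minus3 (Suc m)"
proof -
  let ?s = "Suc m"
  define c where "c = (\<lambda>n. 1 / (3 * real n + 1) ^ ?s - 1 / (3 * real n + 2) ^ ?s)"
  define d where "d = (\<lambda>n. (- 1) ^ n * (1 / (3 * real n + 1) ^ ?s + 1 / (3 * real n + 2) ^ ?s))"
  have c: "c sums L_minus3 ?s"
    unfolding c_def using assms by (intro L_minus3_sums) auto
  have "(\<lambda>n. (- 1) ^ n * (pow.moment m (3 * real n) + pow.moment m (3 * real n + 1)))
      = (\<lambda>n. (- 1) ^ m * fact m * d n)"
    by (simp add: pow_moment d_def fun_eq_iff algebra_simps)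
  then have d: "(\<lambda>n. (- 1) ^ m * fact m * d n) sums log_integral m"
    using alternating_pow_moments_sums[of m] by simp
  have pair: "sum f {n * 2..<n * 2 + 2} = f (2 * n) + f (2 * n + 1)" for f :: "nat \<Rightarrow> real" and n
    by (simp add: mult.commute)
  have "d (2 * k) + d (2 * k + 1) = (c (2 * k) + c (2 * k + 1)) + 2 / 2 ^ ?s * c k" for k
  proof -
    have "(6 * real k + 2) ^ ?s = 2 ^ ?s * (3 * real k + 1) ^ ?s"
      "(6 * real k + 4) ^ ?s = 2 ^ ?s * (3 * real k + 2) ^ ?s"
      by (simp_all add: algebra_simps flip: power_mult_distrib del: power_Suc)
    then have "2 / 2 ^ ?s * c k = 2 / (6 * real k + 2) ^ ?s - 2 / (6 * real k + 4) ^ ?s"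
      by (simp add: c_def right_diff_distrib del: power_Suc)
    then show ?thesis
      by (simp add: c_def d_def algebra_simps del: power_Suc)
  qed
  moreover have "(\<lambda>k. (c (2 * k) + c (2 * k + 1)) + 2 / 2 ^ ?s * c k)
      sums (L_minus3 ?s + 2 / 2 ^ ?s * L_minus3 ?s)"
    using sums_add[OF sums_group[OF c, of 2, unfolded pair] sums_mult[OF c, of "2 / 2 ^ ?s"]] by simp
  ultimately have "(\<lambda>k. (- 1) ^ m * fact m * (d (2 * k) + d (2 * k + 1)))
      sums ((- 1) ^ m * fact m * (L_minus3 ?s + 2 / 2 ^ ?s * L_minus3 ?s))"
    by (simp only: sums_mult)
  moreover have "(\<lambda>k. (- 1) ^ m * fact m * (d (2 * k) + d (2 * k + 1))) sums log_integral m"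
    using sums_group[OF d, of 2, unfolded pair] by (simp add: distrib_left)
  ultimately show ?thesis
    using sums_unique2 by (fastforce simp: algebra_simps)
qed

text \<open>Completing the square gives an arctangent primitive, symmetric about t = 1/2.\<close>

lemma log_integral_0: "log_integral 0 = 2 * pi / (3 * sqrt 3)"
proof -
  let ?F = "\<lambda>t. 2 / sqrt 3 * arctan ((2 * t - 1) / sqrt 3)"
  have "((\<lambda>t. ?F t) has_real_derivative 1 / (1 - t + t\<^sup>2)) (at t within {0..1})" for t
  proof -
    have "2 / sqrt 3 * (2 / sqrt 3 / (1 + ((2 * t - 1) / sqrt 3)\<^sup>2)) = 1 / (1 - t + t\<^sup>2)"
    proof -
      have arg: "1 + ((2 * t - 1) / sqrt 3)\<^sup>2 = 4 / 3 * (1 - t + t\<^sup>2)"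
        by (simp add: power_divide power2_eq_square field_simps)
      have "2 / sqrt 3 * (2 / sqrt 3 / X) = 4 / 3 / X" for X
        using power_divide[of 2 "sqrt 3" 2] by (simp add: power2_eq_square)
      moreover have "4 / 3 / (4 / 3 * X) = 1 / X" for X :: real
        by simp
      ultimately show ?thesis
        unfolding arg by (simp only:)
    qed
    then show ?thesis
      by (auto intro!: derivative_eq_intros simp: divide_inverse mult_ac)
  qed
  moreover have "continuous_on {0..1} (\<lambda>t::real. 1 / (1 - t + t\<^sup>2))"
  proof (intro continuous_intros ballI)
    show "1 - t + t\<^sup>2 \<noteq> 0" for t :: real
      using one_minus_mult_ge[of t] by auto
  qed
  ultimately have "(\<integral>t. 1 / (1 - t + t\<^sup>2) \<partial>unit_measure) = ?F 1 - ?F 0"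
    by (intro integral_unit_measure_FTC) (auto simp: has_real_derivative_iff_has_vector_derivative)
  also have "\<dots> = 4 / sqrt 3 * arctan (1 / sqrt 3)"
    by (simp add: arctan_minus flip: minus_divide_left)
  also have "arctan (1 / sqrt 3) = pi / 6"
    using arctan_tan[of "pi / 6"] by (simp add: tan_30)
  finally show ?thesis
    by (simp add: log_integral_def field_simps)
qed

section \<open>Rotation invariance on the unit disc\<close>

definition sixth_root :: complex where
  "sixth_root = Complex (1 / 2) (sqrt 3 / 2)"

lemma sixth_root_square: "sixth_root * sixth_root = sixth_root - 1"
  by (simp add: sixth_root_def complex_eq_iff)

lemma exp_sixth_root: "exp (\<i> * of_real (pi / 3)) = sixth_root"
  unfolding cis_conv_exp [symmetric] by (simp add: complex_eq_iff sixth_root_def cos_60 sin_60)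

lemma exp_minus_sixth_root: "exp (- \<i> * of_real (pi / 3)) = 1 - sixth_root"
proof -
  have arg: "- \<i> * of_real (pi / 3) = \<i> * complex_of_real (- (pi / 3))"
    by simp
  show ?thesis
    unfolding arg cis_conv_exp [symmetric]
    by (simp add: complex_eq_iff sixth_root_def cos_60 sin_60)
qed

lemma norm_sixth_root_affine:
  "norm (1 - of_real t * sixth_root) ^ 2 = 1 - t + t\<^sup>2"
  unfolding cmod_power2 by (simp add: sixth_root_def power2_eq_square algebra_simps)

lemma sixth_root_affine_nonzero: "1 - of_real t * sixth_root \<noteq> 0"
  using norm_sixth_root_affine[of t] one_minus_mult_ge[of t] by auto

text \<open>\<open>sixth_root\<close> and its conjugate \<open>1 - sixth_root\<close> have sum 1 and
  product 1.\<close>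

lemma sixth_root_affine_mult:
  "(1 - of_real t * sixth_root) * (1 - of_real t * (1 - sixth_root)) = of_real (1 - t + t\<^sup>2)"
  using sixth_root_square by (simp add: power2_eq_square) algebra

text \<open>The arc runs from $1$ to $\zeta = e^{2\pi i/3}$, which is \<^term>\<open>sixth_root - 1\<close>; its inverse is \<^term>\<open>- sixth_root\<close>.\<close>

definition circle_arc :: "real \<Rightarrow> complex" where
  "circle_arc t = (1 - of_real t * (1 - sixth_root)) / (1 - of_real t * sixth_root)"

lemma norm_circle_arc: "norm (circle_arc t) = 1"
proof -
  have "1 - of_real t * (1 - sixth_root) = cnj (1 - of_real t * sixth_root)"
    by (simp add: complex_eq_iff sixth_root_def)
  then show ?thesis
    unfolding circle_arc_def norm_divide using sixth_root_affine_nonzero[of t]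
    by (metis complex_mod_cnj divide_self norm_eq_zero)
qed

text \<open>With z on the arc and \<zeta> = \<open>sixth_root - 1\<close>, the left-hand sides are 1
  - z, 1 - z/\<zeta> and 1 - \<zeta>z. Over the common denominator, t and 1 - t split off from the
  first two, which is how ln t and ln (1 - t) arise from differences of complex logarithms.\<close>

lemma one_minus_circle_arc:
  "1 - circle_arc t = of_real t * (1 - 2 * sixth_root) / (1 - of_real t * sixth_root)"
  "1 + sixth_root * circle_arc t = of_real (1 - t) * (1 + sixth_root) / (1 - of_real t * sixth_root)"
  "1 + (1 - sixth_root) * circle_arc t = (2 - sixth_root) / (1 - of_real t * sixth_root)"
proof -
  note nz = sixth_root_affine_nonzero[of t] and sq = sixth_root_square
  show "1 - circle_arc t = of_real t * (1 - 2 * sixth_root) / (1 - of_real t * sixth_root)"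
    unfolding circle_arc_def using nz by (simp add: divide_simps) (simp add: algebra_simps)
  show "1 + sixth_root * circle_arc t = of_real (1 - t) * (1 + sixth_root) / (1 - of_real t * sixth_root)"
    unfolding circle_arc_def using nz sq by (simp add: divide_simps) algebra
  show "1 + (1 - sixth_root) * circle_arc t = (2 - sixth_root) / (1 - of_real t * sixth_root)"
    unfolding circle_arc_def using nz sq by (simp add: divide_simps) algebra
qed

text \<open>In terms of forms, dz/z = i sqrt 3 * dt / (1 - t + t^2), since
  \<open>2 * sixth_root - 1\<close> is i sqrt 3.\<close>

lemma circle_arc_has_vector_derivative:
  "(circle_arc has_vector_derivative (2 * sixth_root - 1) * circle_arc t / of_real (1 - t + t\<^sup>2)) (at t within A)"
proof -
  let ?q = sixth_root
  note nz = sixth_root_affine_nonzero[of t]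
  have "((\<lambda>z. (1 - z * (1 - ?q)) / (1 - z * ?q)) has_field_derivative
      (2 * ?q - 1) / (1 - of_real t * ?q)\<^sup>2) (at (of_real t))"
    using nz by (auto intro!: derivative_eq_intros simp: field_simps power2_eq_square)
  then have "(circle_arc has_vector_derivative (2 * ?q - 1) / (1 - of_real t * ?q)\<^sup>2) (at t within A)"
    unfolding circle_arc_def by (rule has_vector_derivative_real_field)
  moreover have "(2 * ?q - 1) / (1 - of_real t * ?q)\<^sup>2 = (2 * ?q - 1) * circle_arc t / of_real (1 - t + t\<^sup>2)"
  proof -
    have "of_real (1 - t + t\<^sup>2) \<noteq> (0::complex)"
      using one_minus_mult_ge[of t] unfolding of_real_eq_0_iff by linarith
    then have "1 - of_real t * (1 - ?q) \<noteq> 0"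
      unfolding sixth_root_affine_mult[of t, symmetric] by auto
    with nz show ?thesis
      unfolding circle_arc_def sixth_root_affine_mult[of t, symmetric] by (simp add: power2_eq_square)
  qed
  ultimately show ?thesis by simp
qed

text \<open>The integral is a multiple of $P(r\zeta) - P(r)$ for a primitive $P$ of $G(z)/z$, and $P$ inherits
  the rotation invariance of $G$.\<close>

lemma rotation_invariant_arc_integral:
  assumes hol: "G holomorphic_on ball 0 1"
    and rot: "\<And>z. z \<in> ball 0 1 \<Longrightarrow> G ((sixth_root - 1) * z) = G z"
    and G0: "G 0 = 0" and r: "0 \<le> r" "r < 1"
  shows "(\<integral>t. G (of_real r * circle_arc t) / of_real (1 - t + t\<^sup>2) \<partial>unit_measure) = 0"
proof -
  let ?q = sixth_root
  have norm_zeta: "norm (?q - 1) = 1"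
    by (simp add: sixth_root_def cmod_def power2_eq_square)
  have in_ball: "(?q - 1) * z \<in> ball 0 1 \<longleftrightarrow> z \<in> ball 0 1" for z
    using norm_zeta by (simp add: norm_mult)
  \<comment> \<open>This is G(z)/z with its removable singularity at 0 filled in.\<close>
  define k where "k = (\<lambda>z. if z = 0 then deriv G 0 else (G z - G 0) / (z - 0))"
  have hol_k: "k holomorphic_on ball 0 1"
    unfolding k_def using hol by (rule pole_lemma_open) auto
  have zk: "z * k z = G z" for z
    by (simp add: k_def G0)
  obtain P where P: "\<And>z. z \<in> ball 0 1 \<Longrightarrow> (P has_field_derivative k z) (at z within ball 0 1)"
    using holomorphic_convex_primitive'[OF convex_ball open_ball hol_k] by blast
  then have P: "(P has_field_derivative k z) (at z)" if "z \<in> ball 0 1" for z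
    using that by (metis at_within_open open_ball)
  have k_rot: "(?q - 1) * k ((?q - 1) * z) = k z" if z: "z \<in> ball 0 1" for z
  proof (cases "z = 0")
    case True
    \<comment> \<open>At the origin, differentiating G(\<zeta>z) = G(z) gives \<zeta> G'(0) = G'(0),
      which is the claim because k(0) = G'(0).\<close>
    have deriv_G: "(G has_field_derivative deriv G 0) (at 0)"
      using hol by (rule holomorphic_derivI) auto
    then have D: "((\<lambda>z. G ((?q - 1) * z)) has_field_derivative deriv G 0 * (?q - 1)) (at 0)"
      by (intro DERIV_chain2[where g = "\<lambda>z. (?q - 1) * z"]) (auto intro!: derivative_eq_intros)
    have ev: "\<forall>\<^sub>F z in nhds 0. G ((?q - 1) * z) = G z"
      using eventually_nhds_in_open[OF open_ball, of 0 0 1] by (auto elim!: eventually_mono intro!: rot)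
    have "(G has_field_derivative deriv G 0 * (?q - 1)) (at 0)"
      using D by (rule DERIV_cong_ev[OF refl ev refl, THEN iffD1])
    from DERIV_unique[OF this deriv_G] show ?thesis
      using True by (simp add: k_def mult.commute)
  next
    case False
    have nz: "?q - 1 \<noteq> 0" using norm_zeta by auto
    then have "z * ((?q - 1) * k ((?q - 1) * z)) = z * k z"
      using zk[of "(?q - 1) * z"] zk[of z] rot[OF z] by (simp add: mult_ac)
    with False show ?thesis by simp
  qed
  have "\<exists>c. \<forall>z\<in>ball 0 1. P ((?q - 1) * z) - P z = c"
  proof (rule has_field_derivative_zero_constant)
    fix z :: complex assume z: "z \<in> ball 0 1"
    have "((\<lambda>z. P ((?q - 1) * z)) has_field_derivative k ((?q - 1) * z) * (?q - 1)) (at z)"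
      using z in_ball
      by (intro DERIV_chain2[where g = "\<lambda>z. (?q - 1) * z"] P) (auto intro!: derivative_eq_intros)
    from DERIV_diff[OF this P[OF z]]
    have "((\<lambda>z. P ((?q - 1) * z) - P z) has_field_derivative 0) (at z)"
      using k_rot[OF z] by (simp add: mult.commute)
    then show "((\<lambda>z. P ((?q - 1) * z) - P z) has_field_derivative 0) (at z within ball 0 1)"
      by (rule has_field_derivative_at_within)
  qed simp
  then obtain c where c: "P ((?q - 1) * z) - P z = c" if "z \<in> ball 0 1" for z
    by blast
  \<comment> \<open>Evaluating at z = 0, a fixed point of the rotation, shows that the constant c is
    0.\<close>
  have P_rot: "P (of_real r * (?q - 1)) = P (of_real r * 1)"
    using c[of 0] c[of "of_real r"] r by (simp add: mult.commute)
  have inside: "of_real r * circle_arc t \<in> ball 0 1" for t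
    using r by (simp add: norm_mult norm_circle_arc)
  have nzD: "of_real (1 - t + t\<^sup>2) \<noteq> (0::complex)" for t
    using one_minus_mult_ge[of t] unfolding of_real_eq_0_iff by linarith
  have cont_arc: "continuous_on {0..1} circle_arc"
    by (rule continuous_on_vector_derivative[OF circle_arc_has_vector_derivative])
  let ?f = "\<lambda>t. (2 * ?q - 1) * (G (of_real r * circle_arc t) / of_real (1 - t + t\<^sup>2))"
  have "(\<integral>t. ?f t \<partial>unit_measure) = P (of_real r * circle_arc 1) - P (of_real r * circle_arc 0)"
  proof (rule integral_unit_measure_FTC)
    fix t :: real
    have "((\<lambda>t. of_real r * circle_arc t) has_vector_derivative
        of_real r * ((2 * ?q - 1) * circle_arc t / of_real (1 - t + t\<^sup>2))) (at t within {0..1})"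
      by (intro has_vector_derivative_mult_right circle_arc_has_vector_derivative)
    from field_vector_diff_chain_within[OF this has_field_derivative_at_within[OF P[OF inside]]]
    have chain: "((\<lambda>t. P (of_real r * circle_arc t)) has_vector_derivative
        of_real r * ((2 * ?q - 1) * circle_arc t / of_real (1 - t + t\<^sup>2)) * k (of_real r * circle_arc t)) (at t within {0..1})"
      by (simp add: o_def)
    have eq: "of_real r * ((2 * ?q - 1) * circle_arc t / of_real (1 - t + t\<^sup>2)) * k (of_real r * circle_arc t) = ?f t"
      unfolding zk[of "of_real r * circle_arc t", symmetric] by simp
    show "((\<lambda>t. P (of_real r * circle_arc t)) has_vector_derivative ?f t) (at t within {0..1})"
      using chain unfolding eq .
  next
    have "continuous_on {0..1} (\<lambda>t. G (of_real r * circle_arc t))"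
      by (rule continuous_on_compose2[OF holomorphic_on_imp_continuous_on[OF hol]])
        (use inside cont_arc in \<open>auto intro!: continuous_intros\<close>)
    then show "continuous_on {0..1} ?f"
      using nzD by (intro continuous_intros) auto
  qed
  also have "circle_arc 0 = 1"
    by (simp add: circle_arc_def)
  also have "circle_arc 1 = ?q - 1"
    using sixth_root_affine_nonzero[of 1] sixth_root_square by (simp add: circle_arc_def divide_simps) algebra
  finally have "(2 * ?q - 1) * (\<integral>t. G (of_real r * circle_arc t) / of_real (1 - t + t\<^sup>2) \<partial>unit_measure) = 0"
    unfolding P_rot integral_mult_right_zero by simp
  moreover have "2 * ?q - 1 \<noteq> 0"
    by (simp add: sixth_root_def complex_eq_iff)
  ultimately show ?thesis by simp
qed

text \<open>A bound uniform in r, for dominated convergence as r tends to 1. The modulus of 1 - rz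
  is at least 1 - r and at least |1 - z| - (1 - r), hence at least d/2, which bounds the real part
  of the logarithm; the imaginary part is below pi/2 because 1 - rz lies in the right
  half-plane.\<close>

lemma norm_Ln_one_minus_le:
  assumes z: "norm z = 1" and d: "0 < d" "d \<le> norm (1 - z)" "d \<le> 1" and r: "0 \<le> r" "r < 1"
  shows "norm (Ln (1 - of_real r * z)) \<le> 3 - ln d"
proof -
  let ?x = "1 - of_real r * z"
  have nrz: "norm (of_real r * z) = r" using z r by (simp add: norm_mult)
  have "Re (of_real r * z) \<le> r" using complex_Re_le_cmod[of "of_real r * z"] nrz by simp
  then have Re_pos: "Re ?x > 0" using r by simp
  then have nz: "?x \<noteq> 0"
    by (metis less_irrefl zero_complex.sel(1))
  have "\<bar>Im (Ln ?x)\<bar> < pi / 2"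
    using Re_Ln_pos_lt[OF nz] Re_pos by simp
  then have Im: "\<bar>Im (Ln ?x)\<bar> \<le> 2"
    using pi_less_4 by linarith
  have "1 - r \<le> norm ?x"
    using norm_triangle_ineq2[of 1 "of_real r * z"] nrz by simp
  moreover have "norm (1 - z) \<le> norm ?x + norm (of_real r * z - z)"
    using norm_triangle_ineq[of ?x "of_real r * z - z"] by simp
  moreover have "norm (of_real r * z - z) = 1 - r"
  proof -
    have "of_real r * z - z = of_real (r - 1) * z"
      by (simp add: algebra_simps)
    then show ?thesis
      using z r by (simp only: norm_mult norm_of_real) simp
  qed
  ultimately have lower: "d / 2 \<le> norm ?x"
    using d by linarith
  have "norm ?x \<le> 2"
    using norm_triangle_ineq4[of 1 "of_real r * z"] nrz r by simp
  then have "ln (norm ?x) \<le> ln 2"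
    using nz by (intro ln_mono) auto
  moreover have "ln (d / 2) \<le> ln (norm ?x)"
    using d lower by (intro ln_mono) auto
  moreover have "ln (d / 2) = ln d - ln 2" "ln d \<le> 0"
    using d by (auto simp: ln_div)
  moreover have "Re (Ln ?x) = ln (norm ?x)"
    using nz by (rule Re_Ln)
  ultimately have "\<bar>Re (Ln ?x)\<bar> \<le> 1 - ln d"
    using ln_2_less_1 unfolding abs_le_iff by linarith
  with Im show ?thesis
    using cmod_le[of "Ln ?x"] by linarith
qed

text \<open>Built from differences of a, b, c only, so it is cyclic, vanishes when all three agree,
  and sees the logarithms only through their differences. The \<alpha> and \<gamma> parts are
  symmetric; the \<beta> part is the alternating Vandermonde product.\<close>

definition cyclic_poly :: "complex \<Rightarrow> complex \<Rightarrow> complex \<Rightarrow> complex \<Rightarrow> complex \<Rightarrow> complex \<Rightarrow> complex" where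
  "cyclic_poly \<alpha> \<beta> \<gamma> a b c = \<alpha> * ((a - b)\<^sup>2 + (b - c)\<^sup>2 + (c - a)\<^sup>2)
     + \<beta> * ((a - b) * (b - c) * (c - a))
     + \<gamma> * ((a + b - 2 * c) * (b + c - 2 * a) * (c + a - 2 * b))"

lemma cyclic_poly_rotate: "cyclic_poly \<alpha> \<beta> \<gamma> c a b = cyclic_poly \<alpha> \<beta> \<gamma> a b c"
  by (simp add: cyclic_poly_def mult_ac add_ac)

lemma cyclic_poly_translate: "cyclic_poly \<alpha> \<beta> \<gamma> a b c = cyclic_poly \<alpha> \<beta> \<gamma> (a - c) (b - c) 0"
proof -
  have "a - c - (b - c) = a - b" "b - c - 0 = b - c" "0 - (a - c) = c - a"
    "a - c + (b - c) - 2 * 0 = a + b - 2 * c" "b - c + 0 - 2 * (a - c) = b + c - 2 * a"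
    "0 + (a - c) - 2 * (b - c) = c + a - 2 * b"
    by (simp_all add: algebra_simps)
  then show ?thesis
    unfolding cyclic_poly_def by (simp only:)
qed

text \<open>The constants are 3 * 2^2, 2^3 and 4^3, from |x - y| <= 2K and |x + y - 2z| <= 4K; 1 <=
  K lets K^3 dominate the quadratic part too.\<close>

lemma norm_cyclic_poly_le:
  assumes a: "norm a \<le> K" and b: "norm b \<le> K" and c: "norm c \<le> K" and K: "1 \<le> K"
  shows "norm (cyclic_poly \<alpha> \<beta> \<gamma> a b c) \<le> (12 * norm \<alpha> + 8 * norm \<beta> + 64 * norm \<gamma>) * K ^ 3"
proof -
  have diff: "norm (x - y) \<le> 2 * K" if "norm x \<le> K" "norm y \<le> K" for x y :: complex
    using that norm_triangle_ineq4[of x y] by linarith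
  have sum: "norm (x + y - 2 * z) \<le> 4 * K" if "norm x \<le> K" "norm y \<le> K" "norm z \<le> K" for x y z :: complex
    using that norm_triangle_ineq4[of "x + y" "2 * z"] norm_triangle_ineq[of x y]
    by (simp add: norm_mult)
  have sq: "norm ((x - y)\<^sup>2) \<le> 4 * K ^ 3" if "norm x \<le> K" "norm y \<le> K" for x y :: complex
  proof -
    have "norm ((x - y)\<^sup>2) \<le> (2 * K)\<^sup>2"
      using diff[OF that] by (simp only: norm_power power_mono norm_ge_zero)
    also have "\<dots> \<le> 4 * K ^ 3"
      using power_increasing[of 2 3 K] K by (simp add: power_mult_distrib)
    finally show ?thesis .
  qed
  have "norm ((a - b)\<^sup>2 + (b - c)\<^sup>2 + (c - a)\<^sup>2) \<le> 12 * K ^ 3"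
    using norm_triangle_ineq[of "(a - b)\<^sup>2 + (b - c)\<^sup>2" "(c - a)\<^sup>2"] norm_triangle_ineq[of "(a - b)\<^sup>2" "(b - c)\<^sup>2"]
      sq[OF a b] sq[OF b c] sq[OF c a] by linarith
  then have 1: "norm (\<alpha> * ((a - b)\<^sup>2 + (b - c)\<^sup>2 + (c - a)\<^sup>2)) \<le> norm \<alpha> * (12 * K ^ 3)"
    unfolding norm_mult by (rule mult_left_mono) auto
  have "norm ((a - b) * (b - c) * (c - a)) \<le> (2 * K) * (2 * K) * (2 * K)"
    unfolding norm_mult using a b c K by (intro mult_mono diff mult_nonneg_nonneg) auto
  then have 2: "norm (\<beta> * ((a - b) * (b - c) * (c - a))) \<le> norm \<beta> * ((2 * K) * (2 * K) * (2 * K))"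
    unfolding norm_mult by (rule mult_left_mono) auto
  have "norm ((a + b - 2 * c) * (b + c - 2 * a) * (c + a - 2 * b)) \<le> (4 * K) * (4 * K) * (4 * K)"
    unfolding norm_mult using a b c K by (intro mult_mono sum mult_nonneg_nonneg) auto
  then have 3: "norm (\<gamma> * ((a + b - 2 * c) * (b + c - 2 * a) * (c + a - 2 * b)))
      \<le> norm \<gamma> * ((4 * K) * (4 * K) * (4 * K))"
    unfolding norm_mult by (rule mult_left_mono) auto
  have "norm (cyclic_poly \<alpha> \<beta> \<gamma> a b c)
      \<le> norm \<alpha> * (12 * K ^ 3) + norm \<beta> * ((2 * K) * (2 * K) * (2 * K)) + norm \<gamma> * ((4 * K) * (4 * K) * (4 * K))"
    unfolding cyclic_poly_def by (intro norm_triangle_le add_mono 1 2 3)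
  also have "\<dots> = (12 * norm \<alpha> + 8 * norm \<beta> + 64 * norm \<gamma>) * K ^ 3"
    by (simp add: power3_eq_cube algebra_simps)
  finally show ?thesis .
qed

section \<open>Branches of the logarithm and passage to the boundary circle\<close>

lemma not_nonpos_Reals_if_Re_pos: "Re z > 0 \<Longrightarrow> z \<notin> \<real>\<^sub>\<le>\<^sub>0"
  by (auto simp: complex_nonpos_Reals_iff)

lemma Re_one_minus_pos:
  assumes "norm z \<le> 1" "z \<noteq> 1"
  shows "Re (1 - z) > 0"
proof -
  have "Re z \<noteq> 1"
  proof
    assume "Re z = 1"
    then have "(norm z)\<^sup>2 = 1 + (Im z)\<^sup>2" by (simp add: cmod_power2)
    with assms(1) have "(Im z)\<^sup>2 \<le> 0"
      using power_le_one[of "norm z" 2] by simp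
    with \<open>Re z = 1\<close> assms(2) show False by (simp add: complex_eq_iff)
  qed
  then show ?thesis
    using complex_Re_le_cmod[of z] assms(1) by simp
qed

text \<open>In the right half-plane the arguments stay below pi/2 in absolute value, so the
  difference of the logarithms lies in the open strip |Im| < pi, where exp is injective.\<close>

lemma Ln_diff_eqI:
  assumes "Re x > 0" "Re y > 0" "x = exp w * y" "\<bar>Im w\<bar> < pi"
  shows "Ln x - Ln y = w"
proof -
  have nz: "x \<noteq> 0" "y \<noteq> 0" using assms(1,2) by auto
  have e: "exp (Ln x - Ln y) = exp w"
    unfolding exp_diff exp_Ln[OF nz(1)] exp_Ln[OF nz(2)]
    unfolding nonzero_divide_eq_eq[OF nz(2)] by (rule assms(3))
  have "- pi < Im (Ln x - Ln y)" "Im (Ln x - Ln y) \<le> pi"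
    using Re_Ln_pos_lt_imp[OF assms(1)] Re_Ln_pos_lt_imp[OF assms(2)]
    unfolding minus_complex.sel abs_less_iff by linarith+
  then have l1: "Ln (exp (Ln x - Ln y)) = Ln x - Ln y"
    by (rule Ln_exp)
  have "- pi < Im w" "Im w \<le> pi"
    using assms(4) unfolding abs_less_iff by linarith+
  then have l2: "Ln (exp w) = w"
    by (rule Ln_exp)
  show ?thesis
    by (rule trans[OF l1[unfolded e, symmetric] l2])
qed

text \<open>On the arcs scaled by r < 1 the integral of the rotation-invariant G vanishes; dominated
  convergence transports this to r = 1, where the logarithms are singular at the two endpoints of
  the arc.\<close>

lemma cyclic_poly_log_integral:
  defines "h \<equiv> \<lambda>\<alpha> \<beta> \<gamma> t. cyclic_poly \<alpha> \<beta> \<gamma> (of_real (ln t) - \<i> * of_real (pi / 3))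
      (of_real (ln (1 - t)) + \<i> * of_real (pi / 3)) 0 / of_real (1 - t + t\<^sup>2)"
  shows "integrable unit_measure (h \<alpha> \<beta> \<gamma>)" "(\<integral>t. h \<alpha> \<beta> \<gamma> t \<partial>unit_measure) = 0"
proof -
  let ?q = sixth_root
  define G where "G = (\<lambda>z. cyclic_poly \<alpha> \<beta> \<gamma> (Ln (1 - z)) (Ln (1 + ?q * z)) (Ln (1 + (1 - ?q) * z)))"
  define g where "g = (\<lambda>r t. G (of_real r * circle_arc t) / of_real (1 - t + t\<^sup>2))"
  define r where "r = (\<lambda>n. real n / real (Suc n))"
  have r: "0 \<le> r n" "r n < 1" for n by (auto simp: r_def)
  have r_lim: "r \<longlonglongrightarrow> 1"
    unfolding r_def by (rule LIMSEQ_n_over_Suc_n)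
  have sq: "?q * ?q = ?q - 1" by (rule sixth_root_square)
  have norm_q: "norm ?q = 1" "norm (1 - ?q) = 1"
    by (simp_all add: sixth_root_def cmod_def power2_eq_square)
  have norms: "norm z < 1 \<Longrightarrow> norm (- (?q * z)) < 1" "norm z < 1 \<Longrightarrow> norm (- ((1 - ?q) * z)) < 1" for z
    using norm_q by (simp_all add: norm_mult)
  have arg: "1 - y \<notin> \<real>\<^sub>\<le>\<^sub>0" if "norm y < 1" for y :: complex
    by (intro not_nonpos_Reals_if_Re_pos Re_one_minus_pos) (use that in auto)
  have args: "1 - z \<notin> \<real>\<^sub>\<le>\<^sub>0" "1 + ?q * z \<notin> \<real>\<^sub>\<le>\<^sub>0" "1 + (1 - ?q) * z \<notin> \<real>\<^sub>\<le>\<^sub>0"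
    if "norm z < 1" for z
    using arg[OF that] arg[OF norms(1)[OF that]] arg[OF norms(2)[OF that]]
    by (simp_all only: diff_minus_eq_add not_False_eq_True)
  have hol: "G holomorphic_on ball 0 1"
    unfolding G_def cyclic_poly_def using args by (intro holomorphic_intros) auto
  \<comment> \<open>Multiplying z by \<zeta> permutes the three logarithms cyclically.\<close>
  have rot: "G ((?q - 1) * z) = G z" for z
  proof -
    have q: "?q * (?q - 1) = - 1" "(1 - ?q) * (?q - 1) = ?q"
      using sq by (simp_all add: algebra_simps)
    have "1 - (?q - 1) * z = 1 + (1 - ?q) * z" "1 + ?q * ((?q - 1) * z) = 1 - z"
      "1 + (1 - ?q) * ((?q - 1) * z) = 1 + ?q * z"
      unfolding mult.assoc [symmetric] q by (simp_all add: algebra_simps)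
    then show ?thesis
      unfolding G_def by (simp only: cyclic_poly_rotate)
  qed
  have G0: "G 0 = 0"
    by (simp add: G_def cyclic_poly_def)
  have g_integral: "(\<integral>t. g (r n) t \<partial>unit_measure) = 0" for n
    unfolding g_def by (rule rotation_invariant_arc_integral[OF hol rot G0 r])
  have nzD: "of_real (1 - t + t\<^sup>2) \<noteq> (0::complex)" for t
    using one_minus_mult_ge[of t] unfolding of_real_eq_0_iff by linarith
  have g_measurable: "g (r n) \<in> borel_measurable unit_measure" for n
  proof -
    have "continuous_on {0<..<1} circle_arc"
      by (rule continuous_on_vector_derivative[OF circle_arc_has_vector_derivative])
    then have "continuous_on {0<..<1} (\<lambda>t. G (of_real (r n) * circle_arc t))"
      using r[of n] norm_circle_arc
      by (intro continuous_on_compose2[OF holomorphic_on_imp_continuous_on[OF hol]] continuous_intros)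
        (auto simp: norm_mult)
    then have "continuous_on {0<..<1} (g (r n))"
      unfolding g_def using nzD by (intro continuous_intros) auto
    from borel_measurable_continuous_on_restrict[OF this] show ?thesis
      unfolding unit_measure_def by (simp cong: measurable_cong_sets sets_restrict_space_cong)
  qed
  \<comment> \<open>The dominating function: \<open>norm_cyclic_poly_le\<close> with K = 3 - ln
    (t(1-t)), times the bound 4/3 for the reciprocal of the denominator.\<close>
  define w where "w = (\<lambda>t. (12 * norm \<alpha> + 8 * norm \<beta> + 64 * norm \<gamma>) * (3 - ln (t * (1 - t))) ^ 3 * (4 / 3))"
  have w_int: "integrable unit_measure w"
  proof -
    have "integrable unit_measure (\<lambda>t. ln (t * (1 - t)) ^ m)" for m
      using beta.integrable_moment[of 0 m]
      by (rule Bochner_Integration.integrable_cong[THEN iffD1, rotated -1]) auto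
    note powers = this
    have cube: "(3 - x) ^ 3 = 27 - 27 * x ^ 1 + 9 * x ^ 2 - x ^ 3" for x :: real
      by (simp add: power2_eq_square power3_eq_cube algebra_simps)
    have "integrable unit_measure (\<lambda>t. 27 :: real)"
      using integrable_mult_right[OF powers[of 0], of 27] by simp
    note Bochner_Integration.integrable_diff[OF Bochner_Integration.integrable_add[OF
        Bochner_Integration.integrable_diff[OF this integrable_mult_right[OF powers[of 1]]]
        integrable_mult_right[OF powers[of 2]]] powers[of 3]]
    then have "integrable unit_measure (\<lambda>t. (3 - ln (t * (1 - t))) ^ 3)"
      unfolding cube .
    then show ?thesis
      unfolding w_def by (rule integrable_mult_left[OF integrable_mult_right])
  qed
  have key: "norm (g (r n) t) \<le> w t" "(\<lambda>n. g (r n) t) \<longlonglongrightarrow> h \<alpha> \<beta> \<gamma> t"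
    if t: "t \<in> space unit_measure" for t n
  proof -
    have t: "0 < t" "t < 1" using t by auto
    let ?D = "1 - of_real t * ?q"
    \<comment> \<open>A common lower bound for the distances of 1 from z, z/\<zeta> and \<zeta>z: as
      the denominator has modulus at most 1, these distances are at least t, 1 - t and 1.\<close>
    define d where "d = t * (1 - t)"
    have "1 - t + t\<^sup>2 \<le> 1"
      using t by (simp add: power2_eq_square mult_left_le)
    then have D: "norm ?D \<le> 1" "0 < norm ?D"
      using norm_sixth_root_affine[of t] sixth_root_affine_nonzero[of t]
        power_le_one_iff[of "norm ?D" 2] by auto
    have d: "0 < d" "d \<le> 1" "d \<le> t" "d \<le> 1 - t"
      using t mult_left_le[of "1 - t" t] mult_right_le_one_le[of "1 - t" t] by (auto simp: d_def mult_le_one)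
    have divD: "x \<le> norm (c / ?D)" if "x \<le> norm c" for x and c :: complex
    proof -
      have "norm c * 1 \<le> norm c * (1 / norm ?D)"
        using D by (intro mult_left_mono) auto
      with that show ?thesis by (simp add: norm_divide)
    qed
    have n: "1 \<le> norm (1 - 2 * ?q)" "1 \<le> norm (1 + ?q)" "1 \<le> norm (2 - ?q)"
      by (simp_all add: sixth_root_def cmod_def power2_eq_square)
    have far: "d \<le> norm (1 - circle_arc t)" "d \<le> norm (1 - - (?q * circle_arc t))" "d \<le> norm (1 - - ((1 - ?q) * circle_arc t))"
    proof -
      have norm_scale: "d \<le> norm (of_real x * c)" if "d \<le> x" "1 \<le> norm c" for x and c :: complex
      proof -
        have "x * 1 \<le> x * norm c"
          using that d by (intro mult_left_mono) auto
        with that d show ?thesis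
          unfolding norm_mult norm_of_real by linarith
      qed
      show "d \<le> norm (1 - circle_arc t)"
        unfolding one_minus_circle_arc by (rule divD[OF norm_scale[OF d(3) n(1)]])
      show "d \<le> norm (1 - - (?q * circle_arc t))"
        unfolding diff_minus_eq_add one_minus_circle_arc by (rule divD[OF norm_scale[OF d(4) n(2)]])
      have "d \<le> norm (2 - ?q)"
        using n(3) d by linarith
      then show "d \<le> norm (1 - - ((1 - ?q) * circle_arc t))"
        unfolding diff_minus_eq_add one_minus_circle_arc by (rule divD)
    qed
    have unit: "norm (circle_arc t) = 1" "norm (- (?q * circle_arc t)) = 1" "norm (- ((1 - ?q) * circle_arc t)) = 1"
      using norm_q by (simp_all add: norm_mult norm_circle_arc)
    have G_le: "norm (G (of_real (r n) * circle_arc t)) \<le> (12 * norm \<alpha> + 8 * norm \<beta> + 64 * norm \<gamma>) * (3 - ln d) ^ 3"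
    proof -
      have "norm (Ln (1 - of_real (r n) * circle_arc t)) \<le> 3 - ln d"
        "norm (Ln (1 + ?q * (of_real (r n) * circle_arc t))) \<le> 3 - ln d"
        "norm (Ln (1 + (1 - ?q) * (of_real (r n) * circle_arc t))) \<le> 3 - ln d"
        using norm_Ln_one_minus_le[OF unit(1) d(1) far(1) d(2) r(1,2)[of n]]
          norm_Ln_one_minus_le[OF unit(2) d(1) far(2) d(2) r(1,2)[of n]]
          norm_Ln_one_minus_le[OF unit(3) d(1) far(3) d(2) r(1,2)[of n]]
        by (simp_all add: mult_ac)
      moreover have "1 \<le> 3 - ln d"
        using d ln_le_zero_iff[of d] by linarith
      ultimately show ?thesis
        unfolding G_def by (rule norm_cyclic_poly_le)
    qed
    have D_pos: "0 < 1 - t + t\<^sup>2" and D_inv: "1 / (1 - t + t\<^sup>2) \<le> 4 / 3"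
      using one_minus_mult_ge[of t] by (auto simp: field_simps)
    have "norm (g (r n) t) = norm (G (of_real (r n) * circle_arc t)) * (1 / (1 - t + t\<^sup>2))"
      unfolding g_def norm_divide norm_of_real abs_of_pos[OF D_pos] by (simp only: times_divide_eq_right mult_1_right)
    then show "norm (g (r n) t) \<le> w t"
      using mult_mono[OF G_le D_inv order_trans[OF norm_ge_zero G_le]] D_pos by (simp add: w_def d_def)
    have ne: "y \<noteq> 1" if "d \<le> norm (1 - y)" for y :: complex
      using that d(1) by auto
    have Re: "0 < Re (1 - circle_arc t)" "0 < Re (1 + ?q * circle_arc t)" "0 < Re (1 + (1 - ?q) * circle_arc t)"
      using Re_one_minus_pos[OF eq_refl[OF unit(1)] ne[OF far(1)]] Re_one_minus_pos[OF eq_refl[OF unit(2)] ne[OF far(2)]]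
        Re_one_minus_pos[OF eq_refl[OF unit(3)] ne[OF far(3)]]
      by (simp_all only: diff_minus_eq_add)
    have seq: "(\<lambda>n. of_real (r n) * circle_arc t) \<longlonglongrightarrow> circle_arc t"
      using tendsto_mult[OF tendsto_of_real[OF r_lim] tendsto_const[of "circle_arc t"]] by simp
    have Ln_lim: "(\<lambda>n. Ln (1 - of_real (r n) * circle_arc t)) \<longlonglongrightarrow> Ln (1 - circle_arc t)"
      by (intro tendsto_Ln not_nonpos_Reals_if_Re_pos Re(1) tendsto_diff tendsto_const seq)
    have Ln_lim': "(\<lambda>n. Ln (1 + c * (of_real (r n) * circle_arc t))) \<longlonglongrightarrow> Ln (1 + c * circle_arc t)"
      if "0 < Re (1 + c * circle_arc t)" for c
      by (intro tendsto_Ln not_nonpos_Reals_if_Re_pos that tendsto_add tendsto_mult tendsto_const seq)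
    have "(\<lambda>n. G (of_real (r n) * circle_arc t)) \<longlonglongrightarrow> G (circle_arc t)"
      unfolding G_def cyclic_poly_def
      by (intro tendsto_add tendsto_mult tendsto_diff tendsto_power tendsto_const
          Ln_lim Ln_lim'[OF Re(2)] Ln_lim'[OF Re(3)])
    moreover have "G (circle_arc t) = cyclic_poly \<alpha> \<beta> \<gamma> (of_real (ln t) - \<i> * of_real (pi / 3))
      (of_real (ln (1 - t)) + \<i> * of_real (pi / 3)) 0"
    proof -
      have "1 - circle_arc t = exp (of_real (ln t) - \<i> * of_real (pi / 3)) * (1 + (1 - ?q) * circle_arc t)"
      proof -
        have "exp (of_real (ln t) - \<i> * of_real (pi / 3)) = of_real (exp (ln t)) * exp (- \<i> * of_real (pi / 3))"
          unfolding exp_of_real [symmetric] exp_add [symmetric] by simp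
        then have "exp (of_real (ln t) - \<i> * of_real (pi / 3)) = of_real t * (1 - ?q)"
          unfolding exp_minus_sixth_root using t by simp
        \<comment> \<open>This factorization makes the ratio of 1 - z to 1 - \<zeta>z equal to t
          e^(-i pi/3).\<close>
        moreover have "1 - 2 * ?q = (1 - ?q) * (2 - ?q)"
          by (simp add: algebra_simps sq)
        ultimately show ?thesis
          unfolding one_minus_circle_arc by simp
      qed
      from Ln_diff_eqI[OF Re(1,3) this]
      have 1: "Ln (1 - circle_arc t) - Ln (1 + (1 - ?q) * circle_arc t) = of_real (ln t) - \<i> * of_real (pi / 3)"
        by simp
      have "1 + ?q * circle_arc t = exp (of_real (ln (1 - t)) + \<i> * of_real (pi / 3)) * (1 + (1 - ?q) * circle_arc t)"
      proof -
        have "exp (of_real (ln (1 - t)) + \<i> * of_real (pi / 3)) = of_real (1 - t) * ?q"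
          unfolding exp_add exp_sixth_root using t by (simp add: exp_of_real)
        \<comment> \<open>Likewise the ratio of 1 - z/\<zeta> to 1 - \<zeta>z is (1 - t) e^(i
          pi/3).\<close>
        moreover have "1 + ?q = ?q * (2 - ?q)"
          by (simp add: algebra_simps sq)
        ultimately show ?thesis
          unfolding one_minus_circle_arc by simp
      qed
      from Ln_diff_eqI[OF Re(2,3) this]
      have 2: "Ln (1 + ?q * circle_arc t) - Ln (1 + (1 - ?q) * circle_arc t) = of_real (ln (1 - t)) + \<i> * of_real (pi / 3)"
        by simp
      \<comment> \<open>Prescribing the shape of the first argument keeps the translation rule from
        rewriting its own result.\<close>
      show ?thesis
        unfolding G_def cyclic_poly_translate[of _ _ _ "Ln (1 - _)"] 1 2 ..
    qed
    ultimately show "(\<lambda>n. g (r n) t) \<longlonglongrightarrow> h \<alpha> \<beta> \<gamma> t"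
      unfolding g_def h_def using nzD[of t] by (intro tendsto_divide) simp_all
  qed
  have h_measurable: "h \<alpha> \<beta> \<gamma> \<in> borel_measurable unit_measure"
    using g_measurable key(2) by (rule borel_measurable_LIMSEQ_metric)
  note dom = h_measurable g_measurable w_int AE_I2[OF key(2)] AE_I2[OF key(1)]
  show "integrable unit_measure (h \<alpha> \<beta> \<gamma>)"
    using dom by (rule integrable_dominated_convergence)
  have "(\<lambda>n. \<integral>t. g (r n) t \<partial>unit_measure) \<longlonglongrightarrow> (\<integral>t. h \<alpha> \<beta> \<gamma> t \<partial>unit_measure)"
    using dom by (rule integral_dominated_convergence)
  then show "(\<integral>t. h \<alpha> \<beta> \<gamma> t \<partial>unit_measure) = 0"
    unfolding g_integral using LIMSEQ_unique tendsto_const by blast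
qed

section \<open>Summation of the derivatives\<close>

lemma log_integral_reflect: "(\<integral>t. ln (1 - t) ^ m / (1 - t + t\<^sup>2) \<partial>unit_measure) = log_integral m"
proof -
  have sym: "1 - (1 - t) + (1 - t)\<^sup>2 = 1 - t + t\<^sup>2" for t :: real
    by (simp add: power2_eq_square algebra_simps)
  show ?thesis
    unfolding log_integral_def
    by (rule integral_unit_measure_reflect[of "\<lambda>t. ln t ^ m / (1 - t + t\<^sup>2)", unfolded sym])
qed

text \<open>Integrability and value are bundled so that integrals of linear combinations follow from
  introduction rules alone.\<close>

lemma has_bochner_integral_logs:
  "has_bochner_integral unit_measure (\<lambda>t. ln (t * (1 - t)) ^ m / (1 - t + t\<^sup>2)) (beta_log_integral m)"
  "has_bochner_integral unit_measure (\<lambda>t. ln t ^ m / (1 - t + t\<^sup>2)) (log_integral m)"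
  "has_bochner_integral unit_measure (\<lambda>t. ln (1 - t) ^ m / (1 - t + t\<^sup>2)) (log_integral m)"
  using integrable_beta_log[of m] integrable_ln_powers[of m 0] integrable_ln_powers[of 0 m]
  by (simp_all add: has_bochner_integral_iff beta_log_integral_def log_integral_reflect)
    (simp add: log_integral_def)

lemma beta_log_integral_1: "beta_log_integral 1 = 2 * log_integral 1"
proof -
  have "beta_log_integral 1
      = (\<integral>t. ln t ^ 1 / (1 - t + t\<^sup>2) + ln (1 - t) ^ 1 / (1 - t + t\<^sup>2) \<partial>unit_measure)"
    unfolding beta_log_integral_def
    by (rule Bochner_Integration.integral_cong) (auto simp: ln_mult add_divide_distrib)
  also have "\<dots> = log_integral 1 + log_integral 1"
    by (intro has_bochner_integral_integral_eq has_bochner_integral_add has_bochner_integral_diff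
        has_bochner_integral_mult_right has_bochner_integral_logs)
  finally show ?thesis by simp
qed

lemma Re_cyclic_poly_log_integral:
  "(\<integral>t. Re (cyclic_poly \<alpha> \<beta> \<gamma> (of_real (ln t) - \<i> * of_real (pi / 3))
      (of_real (ln (1 - t)) + \<i> * of_real (pi / 3)) 0) / (1 - t + t\<^sup>2) \<partial>unit_measure) = 0"
  using integral_Re[OF cyclic_poly_log_integral(1)[of \<alpha> \<beta> \<gamma>]] cyclic_poly_log_integral(2)[of \<alpha> \<beta> \<gamma>]
  by (simp only: Re_divide_of_real zero_complex.sel)

text \<open>The coefficient $-3i/\pi$ is chosen so that the real part of the cyclic polynomial only involves
  $\ln t + \ln(1-t)$.\<close>

lemma beta_log_integral_2: "beta_log_integral 2 = 8 * pi ^ 3 / (27 * sqrt 3)"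
proof -
  have Re: "Re (cyclic_poly 1 (- \<i> * of_real (1 / q)) 0 (of_real a - \<i> * of_real q) (of_real b + \<i> * of_real q) 0)
      = (a + b)\<^sup>2 - 4 * q\<^sup>2" if "q \<noteq> 0" for a b q :: real
    using that by (simp add: cyclic_poly_def power2_eq_square field_simps)
  have pi_third: "pi / 3 \<noteq> 0" by simp
  have "0 = (\<integral>t. ln (t * (1 - t)) ^ 2 / (1 - t + t\<^sup>2)
      - 4 * (pi / 3)\<^sup>2 * (ln t ^ 0 / (1 - t + t\<^sup>2)) \<partial>unit_measure)"
    unfolding Re_cyclic_poly_log_integral[of 1 "- \<i> * of_real (1 / (pi / 3))" 0, symmetric]
      Re[OF pi_third]
    by (rule Bochner_Integration.integral_cong) (auto simp: ln_mult diff_divide_distrib)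
  also have "\<dots> = beta_log_integral 2 - 4 * (pi / 3)\<^sup>2 * log_integral 0"
    by (intro has_bochner_integral_integral_eq has_bochner_integral_add has_bochner_integral_diff
        has_bochner_integral_mult_right has_bochner_integral_logs)
  finally show ?thesis
    by (simp add: log_integral_0 power2_eq_square power3_eq_cube)
qed

text \<open>In the real part of the symmetric cubic, mixed terms in a = ln t and b = ln (1 - t)
  occur only inside (a + b)^3. The pure cubes have equal integrals by reflection, and q = pi/3 turns
  9 q^2 into pi^2.\<close>

lemma beta_log_integral_3:
  "beta_log_integral 3 = 6 * log_integral 3 - 2 * pi\<^sup>2 * log_integral 1"
proof -
  have Re: "Re (cyclic_poly 0 0 1 (of_real a - \<i> * of_real q) (of_real b + \<i> * of_real q) 0)
      = (a + b) ^ 3 - 3 * a ^ 3 - 3 * b ^ 3 + 9 * q\<^sup>2 * (a + b)" for a b q :: real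
    by (simp add: cyclic_poly_def power2_eq_square power3_eq_cube algebra_simps)
  let ?D = "\<lambda>t::real. 1 - t + t\<^sup>2"
  have "0 = (\<integral>t. ln (t * (1 - t)) ^ 3 / ?D t - 3 * (ln t ^ 3 / ?D t) - 3 * (ln (1 - t) ^ 3 / ?D t)
      + pi\<^sup>2 * (ln (t * (1 - t)) ^ 1 / ?D t) \<partial>unit_measure)"
    unfolding Re_cyclic_poly_log_integral[of 0 0 1, symmetric] Re
    by (rule Bochner_Integration.integral_cong)
      (auto simp: ln_mult power_divide add_divide_distrib diff_divide_distrib distrib_left)
  also have "\<dots> = beta_log_integral 3 - 3 * log_integral 3 - 3 * log_integral 3 + pi\<^sup>2 * beta_log_integral 1"
    by (intro has_bochner_integral_integral_eq has_bochner_integral_add has_bochner_integral_diff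
        has_bochner_integral_mult_right has_bochner_integral_logs)
  finally show ?thesis
    unfolding beta_log_integral_1 by simp
qed

section \<open>From f3 to Beta moments, and summation\<close>

lemma Beta_Suc_Suc_diagonal:
  assumes "y > -(1 :: real)"
  shows "Beta (y + 2) (y + 2) = (y + 1) / (2 * (2 * y + 3)) * Beta (y + 1) (y + 1)"
proof -
  have step: "Gamma (z + 1) = z * Gamma z" "Gamma z > 0" if "z > 0" for z :: real
    using that by (auto intro!: Gamma_plus1 Gamma_real_pos elim!: nonpos_Ints_cases)
  have "Gamma (y + 2) = (y + 1) * Gamma (y + 1)"
    using step(1)[of "y + 1"] assms by (simp add: add.assoc)
  moreover have "Gamma (2 * y + 4) = (2 * y + 3) * ((2 * y + 2) * Gamma (2 * y + 2))"
    using step(1)[of "2 * y + 3"] step(1)[of "2 * y + 2"] assms by (simp add: add.assoc)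
  moreover have "Gamma (2 * y + 2) > 0"
    using step(2)[of "2 * y + 2"] assms by simp
  moreover have "y + 2 + (y + 2) = 2 * y + 4" "y + 1 + (y + 1) = 2 * y + 2"
    by simp_all
  ultimately show ?thesis
    using assms unfolding Beta_def by (simp add: divide_simps) (simp add: algebra_simps)
qed

text \<open>With y = 3x, the diagonal recurrence expresses the three consecutive Beta values as
  rational multiples of B(y+1, y+1); their sum has numerator 7y^2 + 27y + 24, which is three times
  the quadratic factor of f3.\<close>

lemma f3_eq_beta_moments:
  assumes "x > -1/6"
  shows "f3 x = 4 / 3 * (\<Sum>j<3. beta.moment 0 (3 * x + real j))"
proof -
  define y where "y = 3 * x"
  have y: "y > -1/2" using assms by (simp add: y_def)
  define g where "g = Beta (y + 1) (y + 1)"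
  have m0: "beta.moment 0 y = g"
    using y by (subst beta_moment_0) (auto simp: g_def)
  have m1: "beta.moment 0 (y + 1) = (y + 1) / (2 * (2 * y + 3)) * g"
    using y Beta_Suc_Suc_diagonal[of y] by (subst beta_moment_0) (auto simp: g_def add.assoc)
  have m2: "beta.moment 0 (y + 2) = (y + 2) / (2 * (2 * y + 5)) * ((y + 1) / (2 * (2 * y + 3)) * g)"
    using y Beta_Suc_Suc_diagonal[of y] Beta_Suc_Suc_diagonal[of "y + 1"]
    by (subst beta_moment_0) (auto simp: g_def add.assoc algebra_simps)
  \<comment> \<open>The hypothesis x > -1/6 says exactly that 2y + 1 > 0, so the Gamma recurrence
    applies here.\<close>
  have "2 * y + 1 \<notin> \<int>\<^sub>\<le>\<^sub>0"
    using y by (auto elim!: nonpos_Ints_cases)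
  from Gamma_plus1[OF this] have "Gamma (2 * y + 2) = (2 * y + 1) * Gamma (2 * y + 1)"
    by (simp add: add.assoc)
  moreover have "y + 1 + (y + 1) = 2 * y + 2" by simp
  ultimately have g_eq: "g = (Gamma (y + 1))\<^sup>2 / ((2 * y + 1) * Gamma (2 * y + 1))"
    by (simp only: g_def Beta_def power2_eq_square)
  have sum: "(\<Sum>j<3. beta.moment 0 (3 * x + real j))
      = (7 * y\<^sup>2 + 27 * y + 24) * 3 / (4 * (2 * y + 3) * (2 * y + 5)) * g"
  proof -
    have "(\<Sum>j<3. beta.moment 0 (3 * x + real j))
        = (1 + (y + 1) / (2 * (2 * y + 3)) + (y + 2) / (2 * (2 * y + 5)) * ((y + 1) / (2 * (2 * y + 3)))) * g"
      by (simp add: numeral_3_eq_3 m0 m1 m2[unfolded numeral_2_eq_2] flip: y_def) (simp add: m2 algebra_simps)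
    also have "1 + (y + 1) / (2 * (2 * y + 3)) + (y + 2) / (2 * (2 * y + 5)) * ((y + 1) / (2 * (2 * y + 3)))
        = (7 * y\<^sup>2 + 27 * y + 24) * 3 / (4 * (2 * y + 3) * (2 * y + 5))"
      using y by (simp add: divide_simps) (simp add: power2_eq_square algebra_simps)
    finally show ?thesis .
  qed
  have "f3 x = (7 * y\<^sup>2 / 3 + 9 * y + 8) * (Gamma (y + 1))\<^sup>2 /
      ((2 * y + 3) / 3 * (2 * y + 1) * (2 * y + 5) * Gamma (2 * y + 1))"
  proof -
    have "2 * x + 1 = (2 * y + 3) / 3" "6 * x + 1 = 2 * y + 1" "6 * x + 5 = 2 * y + 5" "3 * x + 1 = y + 1"
      "21 * x\<^sup>2 + 27 * x + 8 = 7 * y\<^sup>2 / 3 + 9 * y + 8"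
      by (simp_all add: y_def power_mult_distrib)
    then show ?thesis
      unfolding f3_def by (simp only:)
  qed
  also have "\<dots> = (7 * y\<^sup>2 / 3 + 9 * y + 8) / ((2 * y + 3) / 3 * (2 * y + 5)) * g"
    by (simp add: g_eq mult_ac)
  also have "\<dots> = 4 / 3 * ((7 * y\<^sup>2 + 27 * y + 24) * 3 / (4 * (2 * y + 3) * (2 * y + 5)) * g)"
    using y by (simp add: divide_simps)
  finally show ?thesis
    unfolding sum .
qed

text \<open>The formula for m holds on an open half-line and so may be differentiated; the inner
  function 3x + j contributes a factor 3 each time.\<close>

lemma deriv_f3:
  "x > -1/6 \<Longrightarrow> (deriv ^^ m) f3 x = 4 / 3 * 3 ^ m * (\<Sum>j<3. beta.moment m (3 * x + real j))"
proof (induction m arbitrary: x)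
  case 0
  then show ?case by (simp add: f3_eq_beta_moments)
next
  case (Suc m)
  have "\<forall>\<^sub>F z in nhds x. z \<in> {-1/6<..}"
    using Suc.prems by (intro eventually_nhds_in_open) auto
  then have "\<forall>\<^sub>F z in nhds x. (deriv ^^ m) f3 z
      = 4 / 3 * 3 ^ m * (\<Sum>j<3. beta.moment m (3 * z + real j))"
    by eventually_elim (use Suc.IH in auto)
  then have "deriv ((deriv ^^ m) f3) x
      = deriv (\<lambda>z. 4 / 3 * 3 ^ m * (\<Sum>j<3. beta.moment m (3 * z + real j))) x"
    by (rule deriv_cong_ev) simp
  also have "\<dots> = 4 / 3 * 3 ^ m * (\<Sum>j<3. beta.moment (Suc m) (3 * x + real j) * 3)"
  proof (intro DERIV_imp_deriv DERIV_cmult DERIV_sum)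
    fix j :: nat
    have "3 * x + real j > -1" using Suc.prems by simp
    then show "((\<lambda>z. beta.moment m (3 * z + real j)) has_real_derivative
        beta.moment (Suc m) (3 * x + real j) * 3) (at x)"
      by (intro DERIV_chain2[OF beta.moment_has_derivative]) (auto intro!: derivative_eq_intros)
  qed
  finally show ?case
    by (simp add: sum_distrib_right [symmetric])
qed

text \<open>The numbers 3k + j with j < 3 run through every natural number once, so the sum over k
  is the moment series grouped in blocks of three.\<close>

lemma deriv_f3_sums: "(\<lambda>k. (deriv ^^ m) f3 (real k)) sums (4 / 3 * 3 ^ m * beta_log_integral m)"
proof -
  have "sum (\<lambda>n. beta.moment m (real n)) {k * 3..<k * 3 + 3} = (\<Sum>j<3. beta.moment m (3 * real k + real j))" for k
    using sum.shift_bounds_nat_ivl[of "\<lambda>n. beta.moment m (real n)" 0 "k * 3" 3]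
    by (simp add: lessThan_atLeast0 algebra_simps)
  with sums_group[OF beta_moments_sums[of m], of 3]
  have "(\<lambda>k. \<Sum>j<3. beta.moment m (3 * real k + real j)) sums beta_log_integral m"
    by simp
  from sums_mult[OF this, of "4 / 3 * 3 ^ m"] show ?thesis
    by (simp add: deriv_f3)
qed

theorem theorem1p5:
  shows "(\<lambda>k. deriv f3 (real k)) sums (- 12 * L_minus3 2) \<and>
    (\<lambda>k. (deriv ^^ 2) f3 (real k)) sums (32 * pi ^ 3 / (9 * sqrt 3)) \<and>
    (\<lambda>k. (deriv ^^ 3) f3 (real k)) sums (54 * (2 * pi\<^sup>2 * L_minus3 2 - 27 * L_minus3 4))"
proof (intro conjI)
  \<comment> \<open>The factor -3/2 is -1! (1 + 2/2^2); the factor -27/4 in \<open>p3\<close> is -3!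
    (1 + 2/2^4).\<close>
  have p1: "log_integral 1 = - 3 / 2 * L_minus3 2"
    using log_integral_eq_L_minus3[of 1] by (simp add: numeral_2_eq_2)
  have p3: "log_integral 3 = - 27 / 4 * L_minus3 4"
    using log_integral_eq_L_minus3[of 3] by (simp add: fact_numeral)
  have d1: "(deriv ^^ 1) f3 = deriv f3"
    by simp
  show "(\<lambda>k. deriv f3 (real k)) sums (- 12 * L_minus3 2)"
    using deriv_f3_sums[of 1] unfolding d1 by (simp add: beta_log_integral_1[unfolded p1] del: One_nat_def)
  show "(\<lambda>k. (deriv ^^ 2) f3 (real k)) sums (32 * pi ^ 3 / (9 * sqrt 3))"
    using deriv_f3_sums[of 2] by (simp add: beta_log_integral_2)
  show "(\<lambda>k. (deriv ^^ 3) f3 (real k)) sums (54 * (2 * pi\<^sup>2 * L_minus3 2 - 27 * L_minus3 4))"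
    using deriv_f3_sums[of 3] by (simp add: beta_log_integral_3 p1 p3 algebra_simps del: One_nat_def)
qed

end
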